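(* (i) For any integer $n\ge 1$, the even threads entangled with the odd thread $I_n=12\cdots n$ are exactly the $3412$-avoiding involutions of length $n-1$. (ii) For any integer $n\ge 0$, the odd threads entangled with the even thread $D_n=n\cdots 21$ are exactly the complements of the $3412$-avoiding involutions of length $n+1$.
   Context: Permutations are written in one-line notation; $S_n$ is the set of permutations of $\{1,\dots,n\}$ and $|\pi|$ is the length of $\pi$. For $\pi\in S_n$ the complement $c(\pi)\in S_n$ is $c(\pi)(j)=n+1-\pi(j)$. $\emptyset$ is the empty permutation (length $0$). $@$ is a formal symbol, the "antipermutation", regarded as the unique permutation of length $-1$. $I_n$ is the increasing permutation $12\cdots n$ and $D_n$ the decreasing permutation $n\cdots 21$ ($D_0=\emptyset$). An involution is a permutation equal to its inverse; a permutation avoids $3412$ (classical pattern avoidance) if it has no subsequence with the same relative order as $3412$; $\emptyset$ is a $3412$-avoiding involution. The permutation induced by $\pi$ on a set of its entries is the standardization of the corresponding subsequence. A complete Baxter permutation is a permutation $\pi$ of length $2n+1$ such that $\pi(i)$ is even iff $i$ is even, and whenever $\pi(x)=i$, $\pi(y)=i+1$ and $z$ lies strictly between $x$ and $y$, then $\pi(z)<i$ if $i$ is odd and $\pi(z)>i+1$ if $i$ is even. A permutation is alternating if it begins with an ascent and its ascents and descents alternate; it is doubly alternating if it and its inverse are alternating (permutations of length $\le 1$ are doubly alternating). A permutation $\sigma$ of length $n\ge 0$ is a snow leopard permutation if there is a complete Baxter permutation of length $2n+1$ whose even entries induce $\sigma$ and whose odd entries induce a doubly alternating permutation (of length $n+1$).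 By convention $@$ is also a snow leopard permutation; "odd length" includes length $-1$. Snow leopard permutations preserve parity ($\pi(j)$ is even iff $j$ is even). For a parity-preserving $\pi$, $\pi^e$ and $\pi^o$ are the permutations induced by $\pi$ on its even and odd entries; if $|\pi|=2n+1\ge 1$ then $|\pi^e|=n$, $|\pi^o|=n+1$. By convention $@^e=@$, $@^o=\emptyset$. An even thread (resp. odd thread) is a permutation of the form $\pi^e$ (resp. $\pi^o$) for some snow leopard permutation $\pi$ of odd length. An even thread $\alpha$ and an odd thread $\beta$ are entangled if there is a snow leopard permutation $\pi$ of odd length with $\pi^e=\alpha$ and $\pi^o=\beta$. *)

theory Defs
  imports "HOL-Combinatorics.Multiset_Permutations" "HOL-Library.Sublist"
begin

text \<open>A permutation of \<open>{1..n}\<close> is its one-line notation, a list of natural numbers.\<close>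

definition perms :: "nat \<Rightarrow> nat list set" where
  "perms n = permutations_of_set {1..n}"

text \<open>The value \<open>\<pi>(j)\<close>; positions count from 1.\<close>

definition entry :: "nat list \<Rightarrow> nat \<Rightarrow> nat" where
  "entry p j = p ! (j - 1)"

definition perm_inverse :: "nat list \<Rightarrow> nat list" where
  "perm_inverse p =
     map (\<lambda>v. THE j. j \<in> {1..length p} \<and> entry p j = v) [1..<length p + 1]"

definition perm_complement :: "nat list \<Rightarrow> nat list" where
  "perm_complement p = map (\<lambda>v. length p + 1 - v) p"

definition increasing_perm :: "nat \<Rightarrow> nat list" where
  "increasing_perm n = [1..<n + 1]"

definition decreasing_perm :: "nat \<Rightarrow> nat list" where
  "decreasing_perm n = rev [1..<n + 1]"

definition involution :: "nat list \<Rightarrow> bool" where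
  "involution p \<longleftrightarrow> p \<in> perms (length p) \<and> perm_inverse p = p"

definition standardize :: "nat list \<Rightarrow> nat list" where
  "standardize xs = map (\<lambda>x. card {y \<in> set xs. y \<le> x}) xs"

text \<open>Classical pattern avoidance, for a pattern \<open>q\<close> that is itself a permutation.\<close>

definition avoids :: "nat list \<Rightarrow> nat list \<Rightarrow> bool" where
  "avoids p q \<longleftrightarrow> \<not> (\<exists>xs. subseq xs p \<and> standardize xs = q)"

definition induced_even :: "nat list \<Rightarrow> nat list" where
  "induced_even p = standardize (filter even p)"

definition induced_odd :: "nat list \<Rightarrow> nat list" where
  "induced_odd p = standardize (filter odd p)"

definition complete_Baxter :: "nat list \<Rightarrow> bool" where
  "complete_Baxter p \<longleftrightarrow>
     p \<in> perms (length p) \<and> odd (length p) \<and>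
     (\<forall>i\<in>{1..length p}. even (entry p i) \<longleftrightarrow> even i) \<and>
     (\<forall>x\<in>{1..length p}. \<forall>y\<in>{1..length p}. \<forall>z\<in>{1..length p}. \<forall>i.
        entry p x = i \<and> entry p y = i + 1 \<and> (x < z \<and> z < y \<or> y < z \<and> z < x) \<longrightarrow>
          (odd i \<longrightarrow> entry p z < i) \<and> (even i \<longrightarrow> entry p z > i + 1))"

text \<open>Starting with an ascent: ascents are exactly at the odd positions. This holds
  vacuously for permutations of length at most 1.\<close>

definition alternating :: "nat list \<Rightarrow> bool" where
  "alternating p \<longleftrightarrow>
     (\<forall>j\<in>{1..<length p}.
        if odd j then entry p j < entry p (j + 1) else entry p j > entry p (j + 1))"

definition doubly_alternating :: "nat list \<Rightarrow> bool" where
  "doubly_alternating p \<longleftrightarrow> alternating p \<and> alternating (perm_inverse p)"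

text \<open>\<open>Anti\<close> is the antipermutation \<open>@\<close>, of length \<open>-1\<close>.\<close>

datatype xperm = Anti | Perm "nat list"

fun xlength :: "xperm \<Rightarrow> int" where
  "xlength Anti = -1"
| "xlength (Perm p) = int (length p)"

fun snow_leopard :: "xperm \<Rightarrow> bool" where
  "snow_leopard Anti \<longleftrightarrow> True"
| "snow_leopard (Perm s) \<longleftrightarrow>
     s \<in> perms (length s) \<and>
     (\<exists>p \<in> perms (2 * length s + 1).
        complete_Baxter p \<and> induced_even p = s \<and> doubly_alternating (induced_odd p))"

fun even_part :: "xperm \<Rightarrow> xperm" where
  "even_part Anti = Anti"
| "even_part (Perm p) = Perm (induced_even p)"

fun odd_part :: "xperm \<Rightarrow> xperm" where
  "odd_part Anti = Perm []"
| "odd_part (Perm p) = Perm (induced_odd p)"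

definition even_thread :: "xperm \<Rightarrow> bool" where
  "even_thread a \<longleftrightarrow> (\<exists>p. snow_leopard p \<and> odd (xlength p) \<and> even_part p = a)"

definition odd_thread :: "xperm \<Rightarrow> bool" where
  "odd_thread b \<longleftrightarrow> (\<exists>p. snow_leopard p \<and> odd (xlength p) \<and> odd_part p = b)"

definition entangled :: "xperm \<Rightarrow> xperm \<Rightarrow> bool" where
  "entangled a b \<longleftrightarrow>
     even_thread a \<and> odd_thread b \<and>
     (\<exists>p. snow_leopard p \<and> odd (xlength p) \<and> even_part p = a \<and> odd_part p = b)"

end

theory Submission
  imports Defs
begin

text \<open>
  All arguments run on the complete Baxter permutation \<open>p\<close>, of length \<open>4d + 3\<close>, behind a snow
  leopard permutation of odd length. The even thread is induced by the entries of \<open>p\<close> divisible by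
  4, the odd thread by the entries congruent to 2 modulo 4. The antipermutation has the empty
  permutation as odd thread and itself as even thread, so it never meets the threads in question.

  The complete Baxter condition passes from \<open>p\<close> to its inverse (\<open>baxter_inverse\<close>), and together with
  double alternation of the odd entries it makes both \<open>p\<close> and its inverse rise, rise, fall, fall
  periodically (\<open>zigzag_of_odd_alternation\<close>). Joining consecutive values by arcs, alternately above
  and below the line of positions, gives a curve without self-crossings whose direction is then
  controlled by the value modulo 4. Counting its turns with weight 1 on the entries congruent to 2
  and weight -1 on those divisible by 4 shows that, if \<open>p\<close> starts with \<open>a > 1\<close>, all entries that are
  at least \<open>a\<close> precede \<open>a - 1\<close> (\<open>leopard_split_at_first\<close>); hence \<open>p = q \<ominus> 1 \<ominus> r\<close> with \<open>q\<close>
  starting with 1. A permutation of this kind that starts with 1 also ends with its maximum, by the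
  same result for the reverse-complement (\<open>leopard_corner\<close>), and therefore it is \<open>123\<close> or
  \<open>12 \<oplus> c(p') \<oplus> 12\<close>. Conversely these constructions preserve all conditions, so the permutations \<open>p\<close>
  are exactly those generated by them (\<open>leopard_list_iff_grown\<close>).

  Write \<open>(\<alpha>, \<beta>)\<close> for the even and odd thread of \<open>p\<close>. Then \<open>123\<close> has threads \<open>(\<emptyset>, 1)\<close>,
  the permutation \<open>12 \<oplus> c(p) \<oplus> 12\<close> has \<open>(c(\<beta>), 1 \<oplus> c(\<alpha>) \<oplus> 1)\<close>, and \<open>q \<ominus> 1 \<ominus> p\<close> has
  \<open>(\<alpha>' \<ominus> 1 \<ominus> \<alpha>, \<beta>' \<ominus> \<beta>)\<close> if \<open>q\<close> has \<open>(\<alpha>', \<beta>')\<close>. An increasing \<open>\<beta>\<close> excludes a skew sum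
  and leads to a permutation whose even thread is decreasing, while a decreasing \<open>\<alpha>\<close> splits into
  decreasing pieces. So the even threads over an increasing \<open>\<beta>\<close>, and (apart from
  \<open>\<emptyset>\<close>) the complements of the odd threads over a decreasing \<open>\<alpha>\<close>, are generated by one recursion:
  \<open>\<emptyset>\<close>, \<open>1 \<oplus> r\<close> and \<open>(1 \<ominus> t \<ominus> 1) \<oplus> r\<close>. These are the \<open>3412\<close>-avoiding involutions (\<open>motzkin_iff\<close>): if such an
  involution exchanges 1 and \<open>k\<close>, an entry above \<open>k\<close> among the first \<open>k\<close> would create the pattern.
\<close>

section \<open>Complete Baxter permutations as pairs of inverse functions\<close>

definition inverse_pair :: "nat \<Rightarrow> (nat \<Rightarrow> nat) \<Rightarrow> (nat \<Rightarrow> nat) \<Rightarrow> bool" where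
  "inverse_pair N P Q \<longleftrightarrow>
     (\<forall>x\<in>{1..N}. P x \<in> {1..N} \<and> Q x \<in> {1..N} \<and> Q (P x) = x \<and> P (Q x) = x)"

text \<open>The complete Baxter condition, with \<open>Q\<close> giving the positions of the values. Keeping the inverse
  as a second argument makes the symmetry between positions and values visible.\<close>

definition baxter :: "nat \<Rightarrow> (nat \<Rightarrow> nat) \<Rightarrow> (nat \<Rightarrow> nat) \<Rightarrow> bool" where
  "baxter N P Q \<longleftrightarrow>
     (\<forall>i z. 1 \<le> i \<and> i < N \<and> 1 \<le> z \<and> z \<le> N \<and>
        (Q i < z \<and> z < Q (i + 1) \<or> Q (i + 1) < z \<and> z < Q i) \<longrightarrow>
        (if odd i then P z < i else P z > i + 1))"

text \<open>The shape rise, rise, fall, fall. It extends to all positions what alternation says about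
  the odd positions alone.\<close>

definition zigzag :: "nat \<Rightarrow> (nat \<Rightarrow> nat) \<Rightarrow> bool" where
  "zigzag N f \<longleftrightarrow>
     (\<forall>i. 1 \<le> i \<and> i < N \<longrightarrow>
        (if i mod 4 = 1 \<or> i mod 4 = 2 then f i < f (i + 1) else f (i + 1) < f i))"

definition same_parity :: "nat \<Rightarrow> (nat \<Rightarrow> nat) \<Rightarrow> bool" where
  "same_parity N f \<longleftrightarrow> (\<forall>i\<in>{1..N}. even (f i) \<longleftrightarrow> even i)"

definition leopard :: "nat \<Rightarrow> (nat \<Rightarrow> nat) \<Rightarrow> (nat \<Rightarrow> nat) \<Rightarrow> bool" where
  "leopard N P Q \<longleftrightarrow>
     inverse_pair N P Q \<and> same_parity N P \<and> baxter N P Q \<and> zigzag N P \<and> zigzag N Q"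

lemma inverse_pairD:
  assumes "inverse_pair N P Q" "1 \<le> x" "x \<le> N"
  shows "1 \<le> P x" "P x \<le> N" "1 \<le> Q x" "Q x \<le> N" "Q (P x) = x" "P (Q x) = x"
  using assms by (auto simp: inverse_pair_def)

lemma inverse_pair_sym: "inverse_pair N P Q \<Longrightarrow> inverse_pair N Q P"
  by (auto simp: inverse_pair_def)

lemma inverse_pair_eq:
  assumes "inverse_pair N P Q" "1 \<le> x" "x \<le> N" "P x = v"
  shows "Q v = x"
  using assms by (auto simp: inverse_pair_def)

lemma same_parity_sym:
  assumes "inverse_pair N P Q" "same_parity N P"
  shows "same_parity N Q"
  unfolding same_parity_def
proof
  fix v assume v: "v \<in> {1..N}"
  then have "Q v \<in> {1..N}" "P (Q v) = v" using assms(1) by (auto simp: inverse_pair_def)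
  then show "even (Q v) \<longleftrightarrow> even v" using assms(2) unfolding same_parity_def by metis
qed

lemma baxterD:
  assumes "baxter N P Q" "1 \<le> i" "i < N" "1 \<le> z" "z \<le> N"
    "Q i < z \<and> z < Q (i + 1) \<or> Q (i + 1) < z \<and> z < Q i"
  shows "if odd i then P z < i else P z > i + 1"
  using assms unfolding baxter_def by blast

lemma zigzagD:
  assumes "zigzag N f" "1 \<le> i" "i < N"
  shows "if i mod 4 = 1 \<or> i mod 4 = 2 then f i < f (i + 1) else f (i + 1) < f i"
  using assms unfolding zigzag_def by blast

lemma crossing_up:
  fixes f :: "nat \<Rightarrow> bool"
  assumes "u \<le> w" "f u" "\<not> f w"
  shows "\<exists>i. u \<le> i \<and> i < w \<and> f i \<and> \<not> f (i + 1)"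
proof -
  define k where "k = (LEAST k. u \<le> k \<and> \<not> f k)"
  have k: "u \<le> k" "\<not> f k" "k \<le> w"
    using LeastI[of "\<lambda>k. u \<le> k \<and> \<not> f k" w] Least_le[of "\<lambda>k. u \<le> k \<and> \<not> f k" w] assms
    by (auto simp: k_def)
  with assms have "u < k" by (metis le_neq_implies_less)
  have "f (k - 1)"
    using not_less_Least[of "k - 1" "\<lambda>k. u \<le> k \<and> \<not> f k"] \<open>u < k\<close> by (auto simp: k_def)
  with \<open>u < k\<close> k show ?thesis by (intro exI[of _ "k - 1"]) auto
qed

text \<open>Suppose that \<open>w\<close> lies between the values at the adjacent positions \<open>j\<close> and \<open>j + 1\<close>, but on
  the wrong side of them. Follow the consecutive values from \<open>w\<close> to one of the two: somewhere the
  positions of \<open>i\<close> and \<open>i + 1\<close> lie on different sides of the gap between \<open>j\<close> and \<open>j + 1\<close>. One of \<open>j\<close>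
  and \<open>j + 1\<close> is strictly between them and fixes the parity of \<open>i\<close>; parity preservation then puts
  the other one strictly between them as well, where the condition at \<open>i\<close> fails.\<close>

lemma baxter_inverse:
  assumes inv: "inverse_pair N P Q" and par: "same_parity N P" and bax: "baxter N P Q"
  shows "baxter N Q P"
  unfolding baxter_def
proof (intro allI impI)
  fix j w
  assume H: "1 \<le> j \<and> j < N \<and> 1 \<le> w \<and> w \<le> N \<and>
        (P j < w \<and> w < P (j + 1) \<or> P (j + 1) < w \<and> w < P j)"
  note I = inverse_pairD[OF inv]
  have Pj: "1 \<le> P j" "P j \<le> N" "1 \<le> P (j+1)" "P (j+1) \<le> N" "Q (P j) = j" "Q (P (j+1)) = j+1"
    using I H by auto
  have Qw: "1 \<le> Q w" "Q w \<le> N" "P (Q w) = w" using I H by auto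
  have ne: "Q w \<noteq> j" "Q w \<noteq> j + 1" using H Qw by auto
  have pj: "even (P j) \<longleftrightarrow> even j" "even (P (j+1)) \<longleftrightarrow> odd j"
    using par H by (auto simp: same_parity_def)
  have parQ: "even (Q i) \<longleftrightarrow> even i" if "1 \<le> i" "i \<le> N" for i
    using same_parity_sym[OF inv par] that by (auto simp: same_parity_def)
  have bx: "if odd i then P z < i else P z > i + 1"
    if "1 \<le> i" "i < N" "z = j \<or> z = j + 1" "Q i < z \<and> z < Q (i + 1) \<or> Q (i + 1) < z \<and> z < Q i" for i z
    using baxterD[OF bax that(1,2) _ _ that(4)] that H by auto
  have nP: "Q i = j \<Longrightarrow> i = P j" "Q i = j + 1 \<Longrightarrow> i = P (j + 1)" if "1 \<le> i" "i \<le> N" for i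
    using I(6)[of i] that by auto
  show "if odd j then Q w < j else Q w > j + 1"
  proof (rule ccontr)
    assume neg: "\<not> (if odd j then Q w < j else Q w > j + 1)"
    show False
    proof (cases "odd j")
      case True
      with neg ne have gt: "Q w > j + 1" by auto
      show False
      proof (cases "P j < w")
        case True
        with H have 1: "P j < w" "w < P (j+1)" by auto
        obtain i where i: "P j \<le> i" "i < w" "Q i \<le> j" "\<not> Q (i+1) \<le> j"
          using crossing_up[of "P j" w "\<lambda>i. Q i \<le> j"] 1 Pj gt by auto
        \<comment> \<open>Position \<open>j + 1\<close> is strictly between those of \<open>i\<close> and \<open>i + 1\<close> and holds an entry above \<open>i + 1\<close>,
          so \<open>i\<close> is even.\<close>
        have "Q (i+1) \<noteq> j+1" using nP[of "i+1"] i 1 Pj by auto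
        with i have c: "Q i < j+1 \<and> j+1 < Q (i+1)" by auto
        have "even i" using bx[of i "j+1"] c i 1 H Pj by (cases "odd i") auto
        then have "Q i \<noteq> j" using parQ[of "i"] i 1 \<open>odd j\<close> H Pj by auto
        with bx[of i j] c i 1 H Pj \<open>even i\<close> show False by auto
      next
        case False
        with H have 1: "P (j+1) < w" "w < P j" by auto
        obtain i where i: "w \<le> i" "i < P j" "\<not> Q i \<le> j" "Q (i+1) \<le> j"
          using crossing_up[of w "P j" "\<lambda>i. \<not> Q i \<le> j"] 1 Pj gt by auto
        have "Q i \<noteq> j+1" using nP[of "i"] i 1 Pj H by auto
        with i have c: "Q (i+1) < j+1 \<and> j+1 < Q i" by auto
        have "odd i" using bx[of i "j+1"] c i 1 H Pj by (cases "odd i") auto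
        then have "Q (i+1) \<noteq> j" using parQ[of "i+1"] i 1 \<open>odd j\<close> H Pj by auto
        with bx[of i j] c i 1 H Pj \<open>odd i\<close> show False by auto
      qed
    next
      case False
      with neg ne have lt: "Q w < j" by auto
      show False
      proof (cases "P j < w")
        case True
        with H have 1: "P j < w" "w < P (j+1)" by auto
        obtain i where i: "w \<le> i" "i < P (j+1)" "Q i \<le> j" "\<not> Q (i+1) \<le> j"
          using crossing_up[of w "P (j+1)" "\<lambda>i. Q i \<le> j"] 1 Pj lt by auto
        have "Q i \<noteq> j" using nP[of i] i 1 Pj H by auto
        with i have c: "Q i < j \<and> j < Q (i+1)" by auto
        have "odd i" using bx[of i j] c i 1 H Pj by (cases "odd i") auto
        then have "Q (i+1) \<noteq> j+1" using \<open>odd i\<close> parQ[of "i+1"] i 1 \<open>\<not> odd j\<close>  H Pj by auto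
        with bx[of i "j+1"] c i 1 H Pj \<open>odd i\<close> show False by auto
      next
        case False
        with H have 1: "P (j+1) < w" "w < P j" by auto
        obtain i where i: "P (j+1) \<le> i" "i < w" "\<not> Q i \<le> j" "Q (i+1) \<le> j"
          using crossing_up[of "P (j+1)" w "\<lambda>i. \<not> Q i \<le> j"] 1 Pj lt by auto
        have "Q (i+1) \<noteq> j" using nP[of "i+1"] i 1 Pj H by auto
        with i have c: "Q (i+1) < j \<and> j < Q i" by auto
        have "even i" using bx[of i j] c i 1 H Pj by (cases "odd i") auto
        then have "Q i \<noteq> j+1" using parQ[of "i"] i 1 \<open>\<not> odd j\<close>  H Pj by auto
        with bx[of i "j+1"] c i 1 H Pj \<open>even i\<close> show False by auto
      qed
    qed
  qed
qed

text \<open>The even value between two consecutive odd values must stand between them: outside that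
  interval, it would leave one of the two odd values strictly between the positions of consecutive
  values, on the wrong side for the Baxter condition.\<close>

lemma zigzag_of_odd_alternation:
  assumes inv: "inverse_pair N P Q" and bax: "baxter N P Q" and N: "odd N"
    and alt: "\<And>i. 1 \<le> i \<Longrightarrow> i + 2 \<le> N \<Longrightarrow> odd i \<Longrightarrow>
      (if i mod 4 = 1 then Q i < Q (i + 2) else Q (i + 2) < Q i)"
  shows "zigzag N Q"
  unfolding zigzag_def
proof (intro allI impI)
  fix i assume i: "1 \<le> i \<and> i < N"
  define k where "k = (if odd i then i else i - 1)"
  have k: "odd k" "1 \<le> k" "k + 2 \<le> N" "i = k \<or> i = k + 1"
    using i N unfolding k_def by (auto elim!: oddE evenE)
  have Qk: "1 \<le> Q k" "Q k \<le> N" "P (Q k) = k" "1 \<le> Q (k+2)" "Q (k+2) \<le> N" "P (Q (k+2)) = k+2"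
     "P (Q (k+1)) = k+1"
    using inverse_pairD[OF inv] k by auto
  have ne: "Q k \<noteq> Q (k+1)" "Q (k+1) \<noteq> Q (k+2)"
    using Qk by force+
  have b1: "\<not> (Q k < Q (k+2) \<and> Q (k+2) < Q (k + 1) \<or> Q (k + 1) < Q (k+2) \<and> Q (k+2) < Q k)"
    using baxterD[OF bax, of k "Q (k+2)"] k Qk by auto
  have b2: "\<not> (Q (k+1) < Q k \<and> Q k < Q (k + 2) \<or> Q (k + 2) < Q k \<and> Q k < Q (k+1))"
    using baxterD[OF bax, of "k+1" "Q k"] k Qk by auto
  have m: "k mod 4 = 1 \<or> k mod 4 = 3" using k(1) by presburger
  have m1: "k mod 4 = 1 \<Longrightarrow> (k+1) mod 4 = 2" "k mod 4 = 3 \<Longrightarrow> (k+1) mod 4 = 0"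
    by presburger+
  show "if i mod 4 = 1 \<or> i mod 4 = 2 then Q i < Q (i + 1) else Q (i + 1) < Q i"
    using k(4) m m1 alt[OF k(2,3,1)] b1 b2 ne by (elim disjE) (auto split: if_splits)
qed

lemma even_mod_4_cases:
  fixes v :: nat
  assumes "even v" "2 \<le> v"
  shows "v mod 4 = 2 \<and> (v - 1) mod 4 = 1 \<or> v mod 4 = 0 \<and> (v - 1) mod 4 = 3"
proof -
  obtain k where k: "v = 2 * k" using assms(1) by auto
  show ?thesis
  proof (cases "even k")
    case True
    then obtain d where "k = 2 * d" by auto
    with k assms(2) have v: "v = 4 * d" "v - 1 = 4 * (d - 1) + 3" by auto
    show ?thesis unfolding v(2) by (simp add: v(1))
  next
    case False
    then obtain d where "k = 2 * d + 1" by (auto elim: oddE)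
    with k have v: "v = 4 * d + 2" "v - 1 = 4 * d + 1" by auto
    show ?thesis unfolding v(2) unfolding v(1) by presburger
  qed
qed

text \<open>An even entry \<open>v\<close> at position \<open>x\<close> lies between the entries next to it, and in the position
  order between \<open>v - 1\<close> and \<open>v + 1\<close>. If \<open>v\<close> and \<open>x\<close> differed modulo 4, the neighbour of \<open>x\<close> on the
  side of \<open>v - 1\<close> would be larger than \<open>v\<close>, against the condition at the odd value \<open>v - 1\<close>.
  This is parity preservation of snow leopard permutations.\<close>

lemma leopard_even_mod_4:
  assumes L: "leopard N P Q" and N: "odd N" and x: "1 \<le> x" "x \<le> N" "even x"
  shows "P x mod 4 = x mod 4"
proof -
  have inv: "inverse_pair N P Q" and par: "same_parity N P" and bax: "baxter N P Q"
    and zP: "zigzag N P" and zQ: "zigzag N Q" using L by (auto simp: leopard_def)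
  define v where "v = P x"
  have v: "1 \<le> v" "v \<le> N" "Q v = x" "even v" "P x = v"
    using inverse_pairD[OF inv x(1,2)] par x by (auto simp: v_def same_parity_def)
  have vN: "2 \<le> v" "v < N" "2 \<le> x" "x < N" using v x N by (auto intro: le_neq_implies_less elim!: evenE)
  have odd: "odd (v - 1)" using v vN by auto
  have nz: "v - 1 + 1 = v" using vN by auto
  have I: "P (Q (v-1)) = v-1" "1 \<le> Q (v-1)" "Q (v-1) \<le> N" using inverse_pairD[OF inv, of "v-1"] vN by auto
  have B: "P z < v - 1" if "1 \<le> z" "z \<le> N" "Q (v-1) < z \<and> z < x \<or> x < z \<and> z < Q (v-1)" for z
    using baxterD[OF bax, of "v-1" z] that vN odd nz v by auto
  note z1 = zigzagD[OF zQ, of "v-1"] and z2 = zigzagD[OF zQ, of v]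
    and z3 = zigzagD[OF zP, of "x-1"] and z4 = zigzagD[OF zP, of x]
  have xn: "x - 1 + 1 = x" using vN by auto
  have mv: "v mod 4 = 2 \<and> (v-1) mod 4 = 1 \<or> v mod 4 = 0 \<and> (v-1) mod 4 = 3" using even_mod_4_cases vN v by auto
  have mx: "x mod 4 = 2 \<and> (x-1) mod 4 = 1 \<or> x mod 4 = 0 \<and> (x-1) mod 4 = 3" using even_mod_4_cases vN x by auto
  have b1: "Q (v-1) < x - 1 \<Longrightarrow> P (x-1) < v - 1" using B[of "x-1"] vN by auto
  have b2: "Q (v-1) > x + 1 \<Longrightarrow> P (x+1) < v - 1" using B[of "x+1"] vN by auto
  have e1: "Q (v-1) = x-1 \<Longrightarrow> P (x-1) = v - 1" using I by auto
  have e2: "Q (v-1) = x+1 \<Longrightarrow> P (x+1) = v - 1" using I by auto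
  have "v mod 4 = x mod 4"
    using mv mx
  proof (elim disjE)
    assume m: "v mod 4 = 2 \<and> (v - 1) mod 4 = 1" "x mod 4 = 0 \<and> (x - 1) mod 4 = 3"
    then have "Q (v-1) < x" "P (x-1) > v" using z1 z3 vN v nz xn by auto
    then show ?thesis using b1 e1 by linarith
  next
    assume m: "v mod 4 = 0 \<and> (v - 1) mod 4 = 3" "x mod 4 = 2 \<and> (x - 1) mod 4 = 1"
    then have "Q (v-1) > x" "P (x+1) > v" using z1 z4 vN v nz xn by auto
    then show ?thesis using b2 e2 by linarith
  qed auto
  then show ?thesis by (simp add: v_def)
qed

section \<open>The winding argument\<close>

text \<open>The number of clockwise half turns that the curve through the values \<open>1, 2, \<dots>\<close> has made when it
  passes the value \<open>n\<close>, if it starts upwards and its arcs go alternately above and below the line.\<close>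

definition winding :: "nat \<Rightarrow> int" where
  "winding n = (if n mod 4 = 2 then 1 else if n mod 4 = 0 then -1 else 0)"

lemma sum_winding:
  "1 \<le> m \<Longrightarrow> (\<Sum>x\<in>{1..<m}. winding x) = (if m mod 4 = 0 \<or> m mod 4 = 3 then 1 else 0)"
proof (induction m rule: nat_induct_at_least)
  case base
  then show ?case by simp
next
  case (Suc m)
  have "m mod 4 < 4" by simp
  then have "m mod 4 = 0 \<or> m mod 4 = 1 \<or> m mod 4 = 2 \<or> m mod 4 = 3" by linarith
  then show ?case using Suc by (auto simp: winding_def mod_Suc)
qed

lemma pred_mod_4:
  fixes m :: nat
  assumes "1 \<le> m"
  shows "m mod 4 = 1 \<Longrightarrow> (m - 1) mod 4 = 0" "m mod 4 = 2 \<Longrightarrow> (m - 1) mod 4 = 1"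
    "m mod 4 = 3 \<Longrightarrow> (m - 1) mod 4 = 2" "m mod 4 = 0 \<Longrightarrow> (m - 1) mod 4 = 3"
  using assms by (cases m; auto simp: mod_Suc split: if_splits)+

text \<open>The first entry is odd, and a value congruent to 3 modulo 4 has the preceding value to its left.\<close>

lemma leopard_first_mod_4:
  assumes L: "leopard N P Q" and N: "1 \<le> N"
  shows "P 1 mod 4 = 1"
proof -
  have inv: "inverse_pair N P Q" and par: "same_parity N P" and zQ: "zigzag N Q"
    using L by (auto simp: leopard_def)
  have I: "1 \<le> P 1" "P 1 \<le> N" "Q (P 1) = 1" using inverse_pairD[OF inv] N by auto
  have odd: "odd (P 1)" using par N by (auto simp: same_parity_def)
  show ?thesis
  proof (rule ccontr)
    assume "P 1 mod 4 \<noteq> 1"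
    then have m: "P 1 mod 4 = 3" using odd by presburger
    then have g: "2 \<le> P 1" by (cases "P 1 = 1") (use I in auto)
    have "(P 1 - 1) mod 4 = 2" using pred_mod_4(3) m I by auto
    then have "Q (P 1 - 1) < Q (P 1)" using zigzagD[OF zQ, of "P 1 - 1"] g I by auto
    moreover have "1 \<le> Q (P 1 - 1)" using inverse_pairD[OF inv, of "P 1 - 1"] g I by auto
    ultimately show False using I by simp
  qed
qed

text \<open>Put \<open>a = P 1\<close> and let \<open>y\<close> be the position of \<open>a - 1\<close>. All entries before \<open>y\<close> are at least \<open>a\<close>.
  Follow the values \<open>a, a + 1, \<dots>\<close>: they can cross \<open>y\<close> to the right only from a value congruent to 1
  modulo 4, and to the left only from one congruent to 3. A return therefore starts with weight
  -1, and once the curve has left, the total weight of the values before \<open>y\<close> stays at most 0. But even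
  entries agree with their positions modulo 4, so this total is the weight of the positions below
  \<open>y\<close>, which is 1.\<close>

lemma leopard_split_at_first:
  assumes L: "leopard N P Q" and N: "odd N" and a: "1 < P 1" and v: "1 \<le> v" "v \<le> N"
  shows "Q v < Q (P 1 - 1) \<longleftrightarrow> P 1 \<le> v"
proof -
  have inv: "inverse_pair N P Q" and par: "same_parity N P" and bax: "baxter N P Q"
    and zP: "zigzag N P" and zQ: "zigzag N Q" using L by (auto simp: leopard_def)
  define a where "a = P 1"
  define y where "y = Q (a - 1)"
  have N1: "1 \<le> N" using N by (cases N) auto
  have a4: "a mod 4 = 1" using leopard_first_mod_4[OF L N1] by (simp add: a_def)
  have aN: "2 \<le> a" "a \<le> N" "Q a = 1" using a inverse_pairD[OF inv, of 1] N1 by (auto simp: a_def)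
  obtain k where "a = 4 * k + 1" using a4 by (metis mod_mult_div_eq add.commute mult.commute)
  with aN have a40: "(a - 1) mod 4 = 0" "even (a - 1)" by auto
  have y: "1 \<le> y" "y \<le> N" "P y = a - 1" using inverse_pairD[OF inv, of "a - 1"] aN by (auto simp: y_def)
  have y4: "y mod 4 = 0"
  proof -
    have "even y" using par y a40 by (auto simp: same_parity_def)
    then show ?thesis using leopard_even_mod_4[OF L N, of y] y a40 by auto
  qed
  have pa: "1 \<le> a - 1" "a - 1 < N" "a - 1 + 1 = a" using aN by auto
  have before: "a \<le> P x" if "1 \<le> x" "x < y" for x
  proof (cases "x = 1")
    case False
    then show ?thesis using baxterD[OF bax pa(1,2), of x] aN a40(2) that y(2)
      unfolding pa(3) y_def by auto
  qed (simp add: a_def)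
  have Qy: "Q v \<noteq> y" if "a \<le> v" "v \<le> N" for v
    using inverse_pairD(6)[OF inv, of v] that y aN by auto
  \<comment> \<open>As \<open>y\<close> holds an entry below \<open>m\<close>, only the arc of an odd \<open>m\<close> can pass over it; the zigzag gives
    its direction.\<close>
  have leave: "m mod 4 = 1" if "a \<le> m" "m < N" "Q m < y" "\<not> Q (m + 1) < y" for m
  proof -
    have "Q m < y \<and> y < Q (m + 1)" using Qy[of "m + 1"] that by auto
    moreover from this have "odd m" using baxterD[OF bax, of m y] that y aN by (cases "odd m") auto
    moreover have "odd m \<Longrightarrow> m mod 4 \<noteq> 2" by presburger
    ultimately show ?thesis using zigzagD[OF zQ, of m] that aN by (cases "m mod 4 = 1") auto
  qed
  have enter: "m mod 4 = 3" if "a \<le> m" "m < N" "\<not> Q m < y" "Q (m + 1) < y" for m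
  proof -
    have "Q (m + 1) < y \<and> y < Q m" using Qy[of "m"] that by auto
    moreover from this have "odd m" using baxterD[OF bax, of m y] that y aN by (cases "odd m") auto
    moreover have "odd m \<Longrightarrow> m mod 4 \<noteq> 1 \<Longrightarrow> m mod 4 = 3" by presburger
    ultimately show ?thesis using zigzagD[OF zQ, of m] that aN by (cases "m mod 4 = 1") auto
  qed
  define F where "F m = (\<Sum>v\<in>{a..m}. if Q v < y then winding v else 0)" for m
  have FSuc: "F (Suc m) = F m + (if Q (Suc m) < y then winding (Suc m) else 0)" if "a \<le> m" for m
    using that by (simp add: F_def)
  have FN: "F N = 1"
  proof -
    have "F N = (\<Sum>v\<in>{v\<in>{a..N}. Q v < y}. winding v)"
      unfolding F_def by (rule sum.inter_filter[symmetric]) simp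
    also have "{v\<in>{a..N}. Q v < y} = P ` {1..<y}"
    proof (intro set_eqI iffI)
      fix v assume "v \<in> {v\<in>{a..N}. Q v < y}"
      then show "v \<in> P ` {1..<y}" using inverse_pairD[OF inv, of v] aN
        by (intro image_eqI[of _ _ "Q v"]) auto
    next
      fix v assume "v \<in> P ` {1..<y}"
      then obtain x where x: "v = P x" "1 \<le> x" "x < y" by auto
      then show "v \<in> {v\<in>{a..N}. Q v < y}" using before[of x] inverse_pairD[OF inv, of x] y by auto
    qed
    also have "(\<Sum>v\<in>P ` {1..<y}. winding v) = (\<Sum>x\<in>{1..<y}. winding (P x))"
    proof (rule sum.reindex_cong[of P])
      show "inj_on P {1..<y}"
      proof (rule inj_on_inverseI)
        fix x assume "x \<in> {1..<y}"
        then show "Q (P x) = x" using inverse_pairD[OF inv, of x] y by auto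
      qed
    qed auto
    also have "\<dots> = (\<Sum>x\<in>{1..<y}. winding x)"
    proof (rule sum.cong[OF refl])
      fix x assume "x \<in> {1..<y}"
      then have x: "1 \<le> x" "x \<le> N" using y by auto
      show "winding (P x) = winding x"
      proof (cases "even x")
        case True
        then show ?thesis using leopard_even_mod_4[OF L N x] by (simp add: winding_def)
      next
        case False
        then have "odd (P x)" using par x by (auto simp: same_parity_def)
        have o: "odd n \<Longrightarrow> winding n = 0" for n unfolding winding_def by presburger
        show ?thesis using o[OF False] o[OF \<open>odd (P x)\<close>] by simp
      qed
    qed
    also have "\<dots> = 1" using sum_winding[OF y(1)] y4 by simp
    finally show ?thesis .
  qed
  \<comment> \<open>After a first excursion the bound must be -1 while the curve is left of \<open>y\<close> between a multiple
    of 4 and the next value congruent to 2, which adds 1.\<close>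
  have inv_F: "(\<forall>v\<in>{a..m}. Q v < y) \<and> F m = (if m mod 4 = 2 \<or> m mod 4 = 3 then 1 else 0)
     \<or> F m \<le> (if Q m < y \<and> (m mod 4 = 0 \<or> m mod 4 = 1) then -1 else 0)"
    if "a \<le> m" "m \<le> N" for m
    using that
  proof (induction m rule: nat_induct_at_least)
    case base
    have "Q a < y" using aN y y4 by (cases "y = 1") auto
    then show ?case using a4 by (simp add: F_def winding_def)
  next
    case (Suc m)
    have m4: "m mod 4 = 0 \<or> m mod 4 = 1 \<or> m mod 4 = 2 \<or> m mod 4 = 3"
      using mod_less_divisor[of 4 m] by linarith
    have w: "m mod 4 = 0 \<Longrightarrow> winding (Suc m) = 0 \<and> Suc m mod 4 = 1"
      "m mod 4 = 1 \<Longrightarrow> winding (Suc m) = 1 \<and> Suc m mod 4 = 2"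
      "m mod 4 = 2 \<Longrightarrow> winding (Suc m) = 0 \<and> Suc m mod 4 = 3"
      "m mod 4 = 3 \<Longrightarrow> winding (Suc m) = -1 \<and> Suc m mod 4 = 0"
      by (auto simp: winding_def mod_Suc)
    have lv: "Q m < y \<Longrightarrow> \<not> Q (Suc m) < y \<Longrightarrow> m mod 4 = 1"
      and en: "\<not> Q m < y \<Longrightarrow> Q (Suc m) < y \<Longrightarrow> m mod 4 = 3"
      using leave[of m] enter[of m] Suc by auto
    have set: "{a..Suc m} = insert (Suc m) {a..m}" using Suc.hyps by auto
    from Suc consider
      (1) "\<forall>v\<in>{a..m}. Q v < y" "F m = (if m mod 4 = 2 \<or> m mod 4 = 3 then 1 else 0)"
      | (2) "F m \<le> (if Q m < y \<and> (m mod 4 = 0 \<or> m mod 4 = 1) then -1 else 0)" by fastforce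
    then show ?case
    proof cases
      case 1
      then have "Q m < y" using Suc.hyps by auto
      then show ?thesis using 1 m4 w lv unfolding FSuc[OF Suc.hyps] set
        by (cases "Q (Suc m) < y"; elim disjE) auto
    next
      case 2
      then show ?thesis using m4 w lv en unfolding FSuc[OF Suc.hyps]
        by (cases "Q m < y"; cases "Q (Suc m) < y"; elim disjE) auto
    qed
  qed
  have all: "\<forall>v\<in>{a..N}. Q v < y" using inv_F[of N] FN aN by (auto split: if_splits)
  show ?thesis
  proof
    assume "Q v < Q (P 1 - 1)"
    then show "P 1 \<le> v" using before[of "Q v"] inverse_pairD[OF inv, of v] v
      by (auto simp: a_def y_def)
  next
    assume "P 1 \<le> v"
    then show "Q v < Q (P 1 - 1)" using all v by (auto simp: a_def y_def)
  qed
qed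

lemma mod_4_complement:
  fixes i k :: nat
  assumes "(i + k) mod 4 = 3"
  shows "i mod 4 = 1 \<or> i mod 4 = 2 \<longleftrightarrow> k mod 4 = 1 \<or> k mod 4 = 2"
  using assms by presburger

lemma leopard_split_position:
  assumes L: "leopard N P Q" and N: "odd N" and a: "1 < P 1"
  shows "Q (P 1 - 1) = N + 2 - P 1"
proof -
  have inv: "inverse_pair N P Q" using L by (auto simp: leopard_def)
  have N1: "1 \<le> N" using N by (cases N) auto
  define y where "y = Q (P 1 - 1)"
  have aN: "P 1 \<le> N" using inverse_pairD[OF inv, of 1] N1 by auto
  have y: "1 \<le> y" "y \<le> N" using inverse_pairD[OF inv, of "P 1 - 1"] a aN by (auto simp: y_def)
  have "P ` {1..<y} = {P 1..N}"
  proof (intro set_eqI iffI)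
    fix v assume "v \<in> {P 1..N}"
    then show "v \<in> P ` {1..<y}"
      using inverse_pairD[OF inv, of v] a leopard_split_at_first[OF L N a, of v]
      by (intro image_eqI[of _ _ "Q v"]) (auto simp: y_def)
  next
    fix v assume "v \<in> P ` {1..<y}"
    then obtain x where x: "v = P x" "1 \<le> x" "x < y" by auto
    then show "v \<in> {P 1..N}"
      using inverse_pairD[OF inv, of x] leopard_split_at_first[OF L N a, of v] y by (auto simp: y_def)
  qed
  moreover have "inj_on P {1..<y}"
  proof (rule inj_on_inverseI)
    fix x assume "x \<in> {1..<y}"
    then show "Q (P x) = x" using inverse_pairD[OF inv, of x] y by auto
  qed
  ultimately have "card {1..<y} = card {P 1..N}" using card_image by metis
  then show ?thesis using y aN by (auto simp: y_def)
qed

text \<open>As \<open>N + 1\<close> is divisible by 4, reversing both positions and values keeps parities, and it turns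
  rises into rises with the residues 1 and 2 exchanged.\<close>

lemma leopard_reverse_complement:
  assumes L: "leopard N P Q" and N: "N mod 4 = 3"
  shows "leopard N (\<lambda>x. N + 1 - P (N + 1 - x)) (\<lambda>v. N + 1 - Q (N + 1 - v))"
proof -
  have inv: "inverse_pair N P Q" and par: "same_parity N P" and bax: "baxter N P Q"
    and zP: "zigzag N P" and zQ: "zigzag N Q" using L by (auto simp: leopard_def)
  note I = inverse_pairD[OF inv]
  have m4: "i mod 4 = 1 \<or> i mod 4 = 2 \<longleftrightarrow> (N - i) mod 4 = 1 \<or> (N - i) mod 4 = 2"
    if "1 \<le> i" "i < N" for i
  proof -
    have "(i + (N - i)) mod 4 = 3" using that N by simp
    then show ?thesis by (rule mod_4_complement)
  qed
  have "odd N" using N by presburger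
  have z: "zigzag N (\<lambda>x. N + 1 - f (N + 1 - x))"
    if zf: "zigzag N f" and r: "\<And>x. 1 \<le> x \<Longrightarrow> x \<le> N \<Longrightarrow> f x \<le> N" for f
    unfolding zigzag_def
  proof (intro allI impI)
    fix i assume i: "1 \<le> i \<and> i < N"
    have e: "N - i + 1 = N + 1 - i" "N + 1 - (i + 1) = N - i" using i by auto
    have b: "f (N + 1 - i) \<le> N" "f (N - i) \<le> N" "1 \<le> N - i" "N - i < N" using r i by auto
    show "if i mod 4 = 1 \<or> i mod 4 = 2 then N + 1 - f (N + 1 - i) < N + 1 - f (N + 1 - (i + 1))
       else N + 1 - f (N + 1 - (i + 1)) < N + 1 - f (N + 1 - i)"
      unfolding e using zigzagD[OF zf b(3,4)] m4[of i] i b(1,2) unfolding e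
      by (cases "i mod 4 = 1 \<or> i mod 4 = 2") auto
  qed
  show ?thesis
    unfolding leopard_def
  proof (intro conjI)
    show "inverse_pair N (\<lambda>x. N + 1 - P (N + 1 - x)) (\<lambda>v. N + 1 - Q (N + 1 - v))"
      unfolding inverse_pair_def
    proof
      fix x assume x: "x \<in> {1..N}"
      then have x': "1 \<le> N + 1 - x" "N + 1 - x \<le> N" by auto
      have "N + 1 - (N + 1 - P (N + 1 - x)) = P (N + 1 - x)" "N + 1 - (N + 1 - Q (N + 1 - x)) = Q (N + 1 - x)"
        using I(2,4)[OF x'] by auto
      moreover have "N + 1 - P (N + 1 - x) \<in> {1..N}" "N + 1 - Q (N + 1 - x) \<in> {1..N}"
        using I(1-4)[OF x'] unfolding atLeastAtMost_iff by linarith+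
      ultimately show "N + 1 - P (N + 1 - x) \<in> {1..N} \<and> N + 1 - Q (N + 1 - x) \<in> {1..N} \<and>
         N + 1 - Q (N + 1 - (N + 1 - P (N + 1 - x))) = x \<and> N + 1 - P (N + 1 - (N + 1 - Q (N + 1 - x))) = x"
        using I(5,6)[OF x'] x by (simp only:) auto
    qed
    show "same_parity N (\<lambda>x. N + 1 - P (N + 1 - x))"
      unfolding same_parity_def
    proof
      fix x assume x: "x \<in> {1..N}"
      then have x': "1 \<le> N + 1 - x" "N + 1 - x \<le> N" by auto
      have "even (P (N + 1 - x)) \<longleftrightarrow> even (N + 1 - x)" using par x' by (auto simp: same_parity_def)
      then show "even (N + 1 - P (N + 1 - x)) \<longleftrightarrow> even x" using x I(2)[OF x'] \<open>odd N\<close> by auto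
    qed
    show "baxter N (\<lambda>x. N + 1 - P (N + 1 - x)) (\<lambda>v. N + 1 - Q (N + 1 - v))"
      unfolding baxter_def
    proof (intro allI impI)
      fix i z
      assume H: "1 \<le> i \<and> i < N \<and> 1 \<le> z \<and> z \<le> N \<and>
        (N + 1 - Q (N + 1 - i) < z \<and> z < N + 1 - Q (N + 1 - (i + 1)) \<or>
         N + 1 - Q (N + 1 - (i + 1)) < z \<and> z < N + 1 - Q (N + 1 - i))"
      have e: "N - i + 1 = N + 1 - i" "N + 1 - (i + 1) = N - i" using H by auto
      have b: "Q (N + 1 - i) \<le> N" "Q (N - i) \<le> N" "P (N + 1 - z) \<le> N" using I H by auto
      have flip: "(N + 1 - a < z \<longleftrightarrow> N + 1 - z < a) \<and> (z < N + 1 - a \<longleftrightarrow> a < N + 1 - z)" if "a \<le> N" for a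
        using H that by linarith
      have "Q (N - i) < N + 1 - z \<and> N + 1 - z < Q (N - i + 1) \<or> Q (N - i + 1) < N + 1 - z \<and> N + 1 - z < Q (N - i)"
        using H flip[OF b(1)] flip[OF b(2)] unfolding e by metis
      moreover have "1 \<le> N - i" "N - i < N" "1 \<le> N + 1 - z" "N + 1 - z \<le> N" using H by linarith+
      ultimately have "if odd (N - i) then P (N + 1 - z) < N - i else P (N + 1 - z) > N - i + 1"
        using baxterD[OF bax] by blast
      moreover have "odd (N - i) \<longleftrightarrow> even i" using H \<open>odd N\<close> by auto
      moreover have "N + 1 - p < i \<longleftrightarrow> p > N - i + 1" "N + 1 - p > i + 1 \<longleftrightarrow> p < N - i" if "p \<le> N" for p
        using H that by linarith+
      ultimately show "if odd i then N + 1 - P (N + 1 - z) < i else N + 1 - P (N + 1 - z) > i + 1"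
        using b(3) unfolding if_bool_eq_conj by blast
    qed
    show "zigzag N (\<lambda>x. N + 1 - P (N + 1 - x))" using z[OF zP] I(2) by auto
    show "zigzag N (\<lambda>v. N + 1 - Q (N + 1 - v))" using z[OF zQ] I(4) by auto
  qed
qed

text \<open>If \<open>P N < N\<close>, splitting the reverse-complement at its first entry would make the entry \<open>N\<close>,
  which it has in position \<open>N\<close>, precede another one.\<close>

lemma leopard_corner:
  assumes L: "leopard N P Q" and N: "N mod 4 = 3" and P1: "P 1 = 1"
  shows "P N = N"
proof (rule ccontr)
  assume ne: "P N \<noteq> N"
  define P' where "P' = (\<lambda>x. N + 1 - P (N + 1 - x))"
  define Q' where "Q' = (\<lambda>v. N + 1 - Q (N + 1 - v))"
  have L': "leopard N P' Q'" unfolding P'_def Q'_def by (rule leopard_reverse_complement[OF L N])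
  have inv: "inverse_pair N P Q" and inv': "inverse_pair N P' Q'" using L L' by (auto simp: leopard_def)
  have N1: "1 \<le> N" "odd N" using N by presburger+
  have "P N \<le> N" using inverse_pairD[OF inv, of N] N1 by auto
  with ne have g: "1 < P' 1" by (auto simp: P'_def)
  have "P' N = N" using P1 by (simp add: P'_def)
  then have "Q' N = N" using inverse_pair_eq[OF inv', of N] N1 by auto
  have PN: "P' 1 \<le> N" using inverse_pairD[OF inv', of 1] N1 by auto
  then have "Q' N < Q' (P' 1 - 1)"
    using leopard_split_at_first[OF L' N1(2) g, of N] N1 by auto
  moreover have "Q' (P' 1 - 1) \<le> N" using inverse_pairD[OF inv', of "P' 1 - 1"] g PN by auto
  ultimately show False using \<open>Q' N = N\<close> by auto
qed

lemma leopard_second: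
  assumes L: "leopard N P Q" and N: "2 < N" and P1: "P 1 = 1"
  shows "P 2 = 2"
proof -
  have inv: "inverse_pair N P Q" and bax: "baxter N P Q" and zQ: "zigzag N Q"
    using L by (auto simp: leopard_def)
  have Q1: "Q 1 = 1" using inverse_pair_eq[OF inv, of 1 1] N P1 by auto
  have 2: "1 \<le> Q 2" "Q 2 \<le> N" "P (Q 2) = 2" "1 \<le> P 2" using inverse_pairD[OF inv, of 2] N by auto
  have "1 < Q 2" using zigzagD[OF zQ, of 1] N Q1 by (auto simp: numeral_2_eq_2)
  moreover have "\<not> 2 < Q 2" using baxterD[OF bax, of 1 2] N Q1 2 by (auto simp: numeral_2_eq_2)
  ultimately have "Q 2 = 2" by auto
  with 2 show ?thesis by simp
qed

lemma leopard_penultimate: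
  assumes L: "leopard N P Q" and N: "N mod 4 = 3" and P1: "P 1 = 1"
  shows "P (N - 1) = N - 1"
proof -
  note L' = leopard_reverse_complement[OF L N]
  have N3: "2 < N" using N by (cases "N \<le> 2") (auto simp: le_Suc_eq numeral_2_eq_2)
  have "N + 1 - P (N + 1 - 2) = 2"
    using leopard_second[OF L' N3] leopard_corner[OF L N P1] by auto
  moreover have "N + 1 - 2 = N - 1" by auto
  ultimately show ?thesis by auto
qed

section \<open>Skew sums and framed complements\<close>

text \<open>The lemma serves both for \<open>P\<close> and for its inverse: the inverse of \<open>q \<ominus> 1 \<ominus> r\<close> has the same
  form with the two blocks exchanged.\<close>

lemma zigzag_skew:
  assumes L: "L mod 4 = 3" and K: "K mod 4 = 3"
    and f1: "\<And>x. 1 \<le> x \<Longrightarrow> x \<le> L \<Longrightarrow> f x = f1 x + (K + 1) \<and> 1 \<le> f1 x"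
    and fm: "f (L + 1) = K + 1"
    and f2: "\<And>x. 1 \<le> x \<Longrightarrow> x \<le> K \<Longrightarrow> f (x + (L + 1)) = f2 x \<and> f2 x \<le> K"
  shows "zigzag (L + K + 1) f \<longleftrightarrow> zigzag L f1 \<and> zigzag K f2"
proof -
  have sh: "(x + (L + 1)) mod 4 = x mod 4" for x using L by presburger
  have L1: "1 \<le> L" "1 \<le> K" using L K by (cases L; cases K; auto)+
  have Lm: "(L + 1) mod 4 = 0" using L by presburger
  show ?thesis
  proof (intro iffI conjI)
    assume z: "zigzag (L + K + 1) f"
    show "zigzag L f1" unfolding zigzag_def
    proof (intro allI impI)
      fix i assume i: "1 \<le> i \<and> i < L"
      show "if i mod 4 = 1 \<or> i mod 4 = 2 then f1 i < f1 (i + 1) else f1 (i + 1) < f1 i"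
        using zigzagD[OF z, of i] f1[of i] f1[of "i + 1"] i by (auto split: if_splits)
    qed
    show "zigzag K f2" unfolding zigzag_def
    proof (intro allI impI)
      fix i assume i: "1 \<le> i \<and> i < K"
      have e: "i + (L + 1) + 1 = i + 1 + (L + 1)" by simp
      show "if i mod 4 = 1 \<or> i mod 4 = 2 then f2 i < f2 (i + 1) else f2 (i + 1) < f2 i"
        using zigzagD[OF z, of "i + (L + 1)"] f2[of i] f2[of "i + 1"] i unfolding e sh
        by (auto split: if_splits)
    qed
  next
    assume z: "zigzag L f1 \<and> zigzag K f2"
    show "zigzag (L + K + 1) f" unfolding zigzag_def
    proof (intro allI impI)
      fix i assume i: "1 \<le> i \<and> i < L + K + 1"
      then consider "i < L" | "i = L" | "i = L + 1" | i' where "i = i' + (L + 1)" "1 \<le> i'" "i' < K"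
      proof -
        have "i < L \<or> i = L \<or> i = L + 1 \<or> i = (i - (L + 1)) + (L + 1) \<and> 1 \<le> i - (L + 1) \<and> i - (L + 1) < K"
          using i by linarith
        then show ?thesis using that by metis
      qed
      then show "if i mod 4 = 1 \<or> i mod 4 = 2 then f i < f (i + 1) else f (i + 1) < f i"
      proof cases
        case 1
        then show ?thesis using zigzagD[of L f1 i] z f1[of i] f1[of "i + 1"] i by auto
      next
        case 2
        then show ?thesis using f1[of L] fm L L1 by auto
      next
        case 3
        have "L + 1 + 1 = 1 + (L + 1)" by simp
        then show ?thesis using f2[of 1] fm Lm L1 3 by auto
      next
        case (4 i')
        have e: "i' + (L + 1) + 1 = i' + 1 + (L + 1)" by simp
        show ?thesis using zigzagD[of K f2 i'] z f2[of i'] f2[of "i' + 1"] i 4 unfolding 4(1) e sh by auto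
      qed
    qed
  qed
qed

text \<open>Both block lengths plus one are divisible by 4, so shifts preserve all residues that matter; only
  the joints at the values \<open>K\<close> and \<open>K + 1\<close>, and at the positions \<open>L\<close> and \<open>L + 1\<close>, need an argument. The
  equivalence is used forwards to decompose and backwards to construct.\<close>

lemma leopard_skew:
  assumes inv: "inverse_pair (L + K + 1) P Q" and inv1: "inverse_pair L P1 Q1"
    and inv2: "inverse_pair K P2 Q2" and L: "L mod 4 = 3" and K: "K mod 4 = 3"
    and P1: "\<And>x. 1 \<le> x \<Longrightarrow> x \<le> L \<Longrightarrow> P x = P1 x + (K + 1)"
    and Pm: "P (L + 1) = K + 1"
    and P2: "\<And>x. 1 \<le> x \<Longrightarrow> x \<le> K \<Longrightarrow> P (x + (L + 1)) = P2 x"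
  shows "leopard (L + K + 1) P Q \<longleftrightarrow> leopard L P1 Q1 \<and> leopard K P2 Q2"
proof -
  let ?N = "L + K + 1"
  have L1: "1 \<le> L" "1 \<le> K" using L K by (cases L; cases K; auto)+
  have ev: "even (L + 1)" "even (K + 1)" using L K by presburger+
  note I1 = inverse_pairD[OF inv1] and I2 = inverse_pairD[OF inv2]
  have Q1: "Q (v + (K + 1)) = Q1 v" if "1 \<le> v" "v \<le> L" for v
    using inverse_pair_eq[OF inv, of "Q1 v"] P1[of "Q1 v"] I1[OF that] by auto
  have Qm: "Q (K + 1) = L + 1"
    using inverse_pair_eq[OF inv _ _ Pm] by auto
  have Q2: "Q v = Q2 v + (L + 1)" if "1 \<le> v" "v \<le> K" for v
    using inverse_pair_eq[OF inv, of "Q2 v + (L + 1)"] P2[of "Q2 v"] I2[OF that] by auto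
  have cs: "x \<le> L \<or> x = L + 1 \<or> (\<exists>x'. x = x' + (L + 1) \<and> 1 \<le> x' \<and> x' \<le> K)"
    if "x \<le> ?N" for x
  proof -
    have "x \<le> L \<or> x = L + 1 \<or> x = (x - (L + 1)) + (L + 1) \<and> 1 \<le> x - (L + 1) \<and> x - (L + 1) \<le> K"
      using that by linarith
    then show ?thesis by blast
  qed
  have par: "same_parity ?N P \<longleftrightarrow> same_parity L P1 \<and> same_parity K P2"
  proof (intro iffI conjI)
    assume p: "same_parity ?N P"
    show "same_parity L P1" unfolding same_parity_def
    proof
      fix x assume "x \<in> {1..L}"
      moreover from this have "even (P x) \<longleftrightarrow> even x" using p by (auto simp: same_parity_def)
      ultimately show "even (P1 x) \<longleftrightarrow> even x" using P1[of x] ev by auto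
    qed
    show "same_parity K P2" unfolding same_parity_def
    proof
      fix x assume x: "x \<in> {1..K}"
      then have "even (P (x + (L + 1))) \<longleftrightarrow> even (x + (L + 1))" using p unfolding same_parity_def by auto
      then show "even (P2 x) \<longleftrightarrow> even x" using P2[of x] ev x by auto
    qed
  next
    assume p: "same_parity L P1 \<and> same_parity K P2"
    show "same_parity ?N P" unfolding same_parity_def
    proof
      fix x assume x: "x \<in> {1..?N}"
      then have "x \<le> ?N" by simp
      from cs[OF this] show "even (P x) \<longleftrightarrow> even x"
      proof (elim disjE exE conjE)
        assume "x \<le> L"
        with x p have "even (P1 x) \<longleftrightarrow> even x" by (auto simp: same_parity_def)
        with P1[of x] x \<open>x \<le> L\<close> ev show ?thesis by auto
      next
        assume "x = L + 1" then show ?thesis using Pm ev by simp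
      next
        fix x' assume "x = x' + (L + 1)" "1 \<le> x'" "x' \<le> K"
        moreover from this have "even (P2 x') \<longleftrightarrow> even x'" using p by (auto simp: same_parity_def)
        ultimately show ?thesis using P2[of x'] ev by auto
      qed
    qed
  qed
  have bax: "baxter ?N P Q \<longleftrightarrow> baxter L P1 Q1 \<and> baxter K P2 Q2"
  proof (intro iffI conjI)
    assume b: "baxter ?N P Q"
    show "baxter L P1 Q1" unfolding baxter_def
    proof (intro allI impI)
      fix i z assume H: "1 \<le> i \<and> i < L \<and> 1 \<le> z \<and> z \<le> L \<and>
        (Q1 i < z \<and> z < Q1 (i + 1) \<or> Q1 (i + 1) < z \<and> z < Q1 i)"
      have e: "i + (K + 1) + 1 = i + 1 + (K + 1)" by simp
      have "if odd (i + (K + 1)) then P z < i + (K + 1) else P z > i + (K + 1) + 1"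
        using baxterD[OF b, of "i + (K + 1)" z] H Q1[of i] Q1[of "i + 1"] unfolding e by auto
      then show "if odd i then P1 z < i else P1 z > i + 1" using P1[of z] H ev by (auto split: if_splits)
    qed
    show "baxter K P2 Q2" unfolding baxter_def
    proof (intro allI impI)
      fix i z assume H: "1 \<le> i \<and> i < K \<and> 1 \<le> z \<and> z \<le> K \<and>
        (Q2 i < z \<and> z < Q2 (i + 1) \<or> Q2 (i + 1) < z \<and> z < Q2 i)"
      have "if odd i then P (z + (L + 1)) < i else P (z + (L + 1)) > i + 1"
        using baxterD[OF b, of i "z + (L + 1)"] H Q2[of i] Q2[of "i + 1"] by auto
      moreover have "P (z + (L + 1)) = P2 z" using P2 H by blast
      ultimately show "if odd i then P2 z < i else P2 z > i + 1" by (simp only:)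
    qed
  next
    assume b: "baxter L P1 Q1 \<and> baxter K P2 Q2"
    show "baxter ?N P Q" unfolding baxter_def
    proof (intro allI impI)
      fix i z assume H: "1 \<le> i \<and> i < ?N \<and> 1 \<le> z \<and> z \<le> ?N \<and>
        (Q i < z \<and> z < Q (i + 1) \<or> Q (i + 1) < z \<and> z < Q i)"
      have zz: "\<exists>z'. z = z' + (L + 1) \<and> 1 \<le> z' \<and> z' \<le> K" if "L + 1 < z" using cs[of z] H that by auto
      have "i < K \<or> i = K \<or> i = K + 1 \<or> i = (i - (K + 1)) + (K + 1) \<and> 1 \<le> i - (K + 1) \<and> i - (K + 1) < L"
        using H by linarith
      then consider "i < K" | "i = K" | "i = K + 1" | i' where "i = i' + (K + 1)" "1 \<le> i'" "i' < L" by metis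
      then show "if odd i then P z < i else P z > i + 1"
      proof cases
        case 1
        then have q: "Q i = Q2 i + (L + 1)" "Q (i + 1) = Q2 (i + 1) + (L + 1)" using Q2 H by auto
        then have "L + 1 < z" using H by linarith
        then obtain z' where z': "z = z' + (L + 1)" "1 \<le> z'" "z' \<le> K" using zz by blast
        then show ?thesis using baxterD[of K P2 Q2 i z'] b 1 H q P2[of z'] by auto
      next
        case 2
        have q: "Q K = Q2 K + (L + 1)" using Q2[of K] L1 by auto
        with H 2 Qm have "L + 1 < z" by auto
        then obtain z' where z': "z = z' + (L + 1)" "1 \<le> z'" "z' \<le> K" using zz by blast
        \<comment> \<open>Joint: \<open>z\<close> lies in the lower block and only has to avoid the position of its maximum.\<close>
        have "P2 z' \<noteq> K" using H 2 Qm q z' I2(5)[OF z'(2,3)] by auto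
        then show ?thesis using I2(2)[OF z'(2,3)] P2[of z'] z' 2 ev by auto
      next
        case 3
        have e: "i + 1 = 1 + (K + 1)" using 3 by simp
        have q: "Q (i + 1) = Q1 1" using Q1[of 1] L1 unfolding e by auto
        have bd: "Q1 1 \<le> L" using I1[of 1] L1 by auto
        have zL: "z \<le> L" "1 \<le> z" using H 3 Qm q bd by auto
        \<comment> \<open>Joint: \<open>z\<close> lies in the upper block and only has to avoid the position of its minimum.\<close>
        have "P1 z \<noteq> 1" using H 3 Qm q bd I1(5)[OF zL(2,1)] by auto
        then show ?thesis using I1(1)[OF zL(2,1)] P1[of z] zL 3 ev by auto
      next
        case (4 i')
        have e: "i + 1 = i' + 1 + (K + 1)" using 4 by simp
        have q: "Q i = Q1 i'" "Q (i + 1) = Q1 (i' + 1)" using Q1[of i'] Q1[of "i' + 1"] 4 unfolding e by auto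
        have bd: "Q1 i' \<le> L" "Q1 (i' + 1) \<le> L" using I1[of i'] I1[of "i' + 1"] 4 by auto
        have zL: "z \<le> L" "1 \<le> z" using H q bd by auto
        have "if odd i' then P1 z < i' else P1 z > i' + 1" using baxterD[of L P1 Q1 i' z] b 4 H q zL by auto
        then show ?thesis using P1[of z] zL 4(1) ev by (auto split: if_splits)
      qed
    qed
  qed
  have zP: "zigzag ?N P \<longleftrightarrow> zigzag L P1 \<and> zigzag K P2"
    by (rule zigzag_skew[OF L K]) (use P1 Pm P2 I1 I2 in auto)
  have "zigzag (K + L + 1) Q \<longleftrightarrow> zigzag K Q2 \<and> zigzag L Q1"
    by (rule zigzag_skew[OF K L]) (use Q1 Qm Q2 I1 I2 in auto)
  then have zQ: "zigzag ?N Q \<longleftrightarrow> zigzag L Q1 \<and> zigzag K Q2" by (auto simp: add.commute)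
  show ?thesis unfolding leopard_def par bax zP zQ using inv inv1 inv2 by blast
qed

lemma add_2_mod_4:
  fixes i :: nat
  shows "(i + 2) mod 4 = 1 \<or> (i + 2) mod 4 = 2 \<longleftrightarrow> \<not> (i mod 4 = 1 \<or> i mod 4 = 2)"
  by presburger

text \<open>The complement exchanges rises and falls, and the shift by 2 exchanges the residues where they
  occur. So the complement put between \<open>12\<close> and \<open>12\<close> satisfies the same conditions. The relation
  between \<open>P\<close> and \<open>P1\<close> is written as a sum to avoid truncated subtraction.\<close>

lemma leopard_frame:
  assumes inv: "inverse_pair (L + 4) P Q" and inv1: "inverse_pair L P1 Q1" and L: "L mod 4 = 3"
    and P12: "P 1 = 1" "P 2 = 2" "P (L + 3) = L + 3" "P (L + 4) = L + 4"
    and P1: "\<And>x. 1 \<le> x \<Longrightarrow> x \<le> L \<Longrightarrow> P (x + 2) + P1 x = L + 3"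
  shows "leopard (L + 4) P Q \<longleftrightarrow> leopard L P1 Q1"
proof -
  let ?N = "L + 4"
  have L1: "1 \<le> L" "odd L" using L by presburger+
  note I1 = inverse_pairD[OF inv1]
  have Q12: "Q 1 = 1" "Q 2 = 2" "Q (L + 3) = L + 3" "Q (L + 4) = L + 4"
    using inverse_pair_eq[OF inv _ _ P12(1)] inverse_pair_eq[OF inv _ _ P12(2)]
      inverse_pair_eq[OF inv _ _ P12(3)] inverse_pair_eq[OF inv _ _ P12(4)] by auto
  have Q1: "Q (v + 2) = Q1 u + 2" if "1 \<le> v" "1 \<le> u" "u + v = L + 1" for u v
  proof -
    have u: "u \<le> L" using that by simp
    have "P (Q1 u + 2) = v + 2" using P1[of "Q1 u"] I1[OF that(2) u] that by simp
    then show ?thesis using inverse_pair_eq[OF inv, of "Q1 u + 2"] I1[OF that(2) u] by simp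
  qed
  have cs: "x = 1 \<or> x = 2 \<or> x = L + 3 \<or> x = L + 4 \<or> (\<exists>x'. x = x' + 2 \<and> 1 \<le> x' \<and> x' \<le> L)"
    if "1 \<le> x" "x \<le> ?N" for x
  proof -
    have "x = 1 \<or> x = 2 \<or> x = L + 3 \<or> x = L + 4 \<or> x = (x - 2) + 2 \<and> 1 \<le> x - 2 \<and> x - 2 \<le> L"
      using that by linarith
    then show ?thesis by blast
  qed
  have cs': "x = 1 \<or> x = 2 \<or> x = L + 2 \<or> x = L + 3 \<or> (\<exists>x'. x = x' + 2 \<and> 1 \<le> x' \<and> x' < L)"
    if "1 \<le> x" "x < ?N" for x
  proof -
    have "x = 1 \<or> x = 2 \<or> x = L + 2 \<or> x = L + 3 \<or> x = (x - 2) + 2 \<and> 1 \<le> x - 2 \<and> x - 2 < L"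
      using that by linarith
    then show ?thesis by blast
  qed
  have par: "same_parity ?N P \<longleftrightarrow> same_parity L P1"
  proof
    assume p: "same_parity ?N P"
    show "same_parity L P1" unfolding same_parity_def
    proof
      fix x assume x: "x \<in> {1..L}"
      then have "even (P (x + 2)) \<longleftrightarrow> even (x + 2)" using p unfolding same_parity_def by auto
      moreover have "even (P (x + 2) + P1 x)" using P1[of x] x L1 by simp
      ultimately show "even (P1 x) \<longleftrightarrow> even x" by (simp only: even_add) auto
    qed
  next
    assume p: "same_parity L P1"
    show "same_parity ?N P" unfolding same_parity_def
    proof
      fix x assume "x \<in> {1..?N}"
      then have x: "1 \<le> x" "x \<le> ?N" by auto
      from cs[OF x] show "even (P x) \<longleftrightarrow> even x"
      proof (elim disjE exE conjE)
        fix x' assume x': "x = x' + 2" "1 \<le> x'" "x' \<le> L"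
        then have "even (P1 x') \<longleftrightarrow> even x'" using p by (auto simp: same_parity_def)
        moreover have "even (P (x' + 2) + P1 x')" using P1[of x'] x' L1 by simp
        ultimately show ?thesis unfolding x'(1) by (simp only: even_add) auto
      qed (use P12 in auto)
    qed
  qed
  have zP: "zigzag ?N P \<longleftrightarrow> zigzag L P1"
  proof
    assume z: "zigzag ?N P"
    show "zigzag L P1" unfolding zigzag_def
    proof (intro allI impI)
      fix i assume i: "1 \<le> i \<and> i < L"
      have e: "i + 2 + 1 = i + 1 + 2" by simp
      have m: "(i + 2) mod 4 = 1 \<or> (i + 2) mod 4 = 2 \<longleftrightarrow> \<not> (i mod 4 = 1 \<or> i mod 4 = 2)" by presburger
      show "if i mod 4 = 1 \<or> i mod 4 = 2 then P1 i < P1 (i + 1) else P1 (i + 1) < P1 i"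
        using zigzagD[OF z, of "i + 2"] P1[of i] P1[of "i + 1"] i unfolding e m
        by (cases "i mod 4 = 1 \<or> i mod 4 = 2") auto
    qed
  next
    assume z: "zigzag L P1"
    show "zigzag ?N P" unfolding zigzag_def
    proof (intro allI impI)
      fix i assume i: "1 \<le> i \<and> i < ?N"
      then have "1 \<le> i" "i < ?N" by auto
      from cs'[OF this] show "if i mod 4 = 1 \<or> i mod 4 = 2 then P i < P (i + 1) else P (i + 1) < P i"
      proof (elim disjE exE conjE)
        assume i: "i = 1"
        have e: "i + 1 = 2" using i by simp
        show ?thesis using P12 unfolding e by (simp add: i)
      next
        assume i: "i = 2"
        have e: "i + 1 = 1 + 2" using i by simp
        show ?thesis using P12 P1[of 1] I1[of 1] L1 unfolding e by (simp add: i)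
      next
        assume i: "i = L + 2"
        have e: "i + 1 = L + 3" using i by simp
        have m: "i mod 4 = 1" using i L by presburger
        show ?thesis using P12 P1[of L] I1[of L] L1 m i unfolding e by simp
      next
        assume i: "i = L + 3"
        have e: "i + 1 = L + 4" using i by simp
        have m: "i mod 4 = 2" using i L by presburger
        show ?thesis using P12 m i unfolding e by simp
      next
        fix i' assume i: "i = i' + 2" "1 \<le> i'" "i' < L"
        have e: "i' + 2 + 1 = i' + 1 + 2" by simp
        have m: "(i' + 2) mod 4 = 1 \<or> (i' + 2) mod 4 = 2 \<longleftrightarrow> \<not> (i' mod 4 = 1 \<or> i' mod 4 = 2)" by presburger
        show ?thesis unfolding i(1) e m
          using zigzagD[OF z, of i'] P1[of i'] P1[of "i' + 1"] i
          by (cases "i' mod 4 = 1 \<or> i' mod 4 = 2") auto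
      qed
    qed
  qed
  have zQ: "zigzag ?N Q \<longleftrightarrow> zigzag L Q1"
  proof
    assume z: "zigzag ?N Q"
    show "zigzag L Q1" unfolding zigzag_def
    proof (intro allI impI)
      fix i assume i: "1 \<le> i \<and> i < L"
      define j where "j = L - i"
      have j: "i + j = L" "1 \<le> j" "j < L" using i by (auto simp: j_def)
      have e: "j + 2 + 1 = j + 1 + 2" by simp
      have m: "(j + 2) mod 4 = 1 \<or> (j + 2) mod 4 = 2 \<longleftrightarrow> \<not> (i mod 4 = 1 \<or> i mod 4 = 2)"
        unfolding add_2_mod_4 using mod_4_complement[of i j, unfolded j(1), OF L] by blast
      show "if i mod 4 = 1 \<or> i mod 4 = 2 then Q1 i < Q1 (i + 1) else Q1 (i + 1) < Q1 i"
        using zigzagD[OF z, of "j + 2"] Q1[of j "i + 1"] Q1[of "j + 1" i] i j unfolding e m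
        by (cases "i mod 4 = 1 \<or> i mod 4 = 2") auto
    qed
  next
    assume z: "zigzag L Q1"
    show "zigzag ?N Q" unfolding zigzag_def
    proof (intro allI impI)
      fix i assume i: "1 \<le> i \<and> i < ?N"
      then have "1 \<le> i" "i < ?N" by auto
      from cs'[OF this] show "if i mod 4 = 1 \<or> i mod 4 = 2 then Q i < Q (i + 1) else Q (i + 1) < Q i"
      proof (elim disjE exE conjE)
        assume i: "i = 1"
        have e: "i + 1 = 2" using i by simp
        show ?thesis using Q12 unfolding e by (simp add: i)
      next
        assume i: "i = 2"
        have e: "i + 1 = 1 + 2" using i by simp
        show ?thesis using Q12 Q1[of 1 L] I1[of L] L1 unfolding e by (simp add: i)
      next
        assume i: "i = L + 2"
        have e: "i + 1 = L + 3" using i by simp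
        have m: "i mod 4 = 1" using i L by presburger
        show ?thesis using Q12 Q1[of L 1] I1[of 1] L1 m i unfolding e by simp
      next
        assume i: "i = L + 3"
        have e: "i + 1 = L + 4" using i by simp
        have m: "i mod 4 = 2" using i L by presburger
        show ?thesis using Q12 m i unfolding e by simp
      next
        fix i' assume i: "i = i' + 2" "1 \<le> i'" "i' < L"
        define j where "j = L - i'"
        have j: "i' + j = L" "1 \<le> j" "j < L" using i by (auto simp: j_def)
        have e: "i' + 2 + 1 = i' + 1 + 2" by simp
        have m: "(i' + 2) mod 4 = 1 \<or> (i' + 2) mod 4 = 2 \<longleftrightarrow> \<not> (j mod 4 = 1 \<or> j mod 4 = 2)"
          unfolding add_2_mod_4 using mod_4_complement[of i' j, unfolded j(1), OF L] by blast
        show ?thesis unfolding i(1) e m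
          using zigzagD[OF z, of j] Q1[of i' "j + 1"] Q1[of "i' + 1" j] i j
          by (cases "j mod 4 = 1 \<or> j mod 4 = 2") auto
      qed
    qed
  qed
  have bax: "baxter ?N P Q \<longleftrightarrow> baxter L P1 Q1"
  proof
    assume b: "baxter ?N P Q"
    show "baxter L P1 Q1" unfolding baxter_def
    proof (intro allI impI)
      fix i z assume H: "1 \<le> i \<and> i < L \<and> 1 \<le> z \<and> z \<le> L \<and>
        (Q1 i < z \<and> z < Q1 (i + 1) \<or> Q1 (i + 1) < z \<and> z < Q1 i)"
      define j where "j = L - i"
      have j: "i + j = L" "1 \<le> j" "j < L" using H by (auto simp: j_def)
      have e: "j + 2 + 1 = j + 1 + 2" by simp
      have q: "Q (j + 2) = Q1 (i + 1) + 2" "Q (j + 2 + 1) = Q1 i + 2"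
        using Q1[of j "i + 1"] Q1[of "j + 1" i] H j unfolding e by auto
      have o: "odd (j + 2) \<longleftrightarrow> even i" using arg_cong[OF j(1), of even] L1 by auto
      have "if odd (j + 2) then P (z + 2) < j + 2 else P (z + 2) > j + 2 + 1"
        using baxterD[OF b, of "j + 2" "z + 2"] H j q by auto
      then show "if odd i then P1 z < i else P1 z > i + 1" using P1[of z] H j o by (auto split: if_splits)
    qed
  next
    assume b: "baxter L P1 Q1"
    show "baxter ?N P Q" unfolding baxter_def
    proof (intro allI impI)
      fix i z assume H: "1 \<le> i \<and> i < ?N \<and> 1 \<le> z \<and> z \<le> ?N \<and>
        (Q i < z \<and> z < Q (i + 1) \<or> Q (i + 1) < z \<and> z < Q i)"
      then have i: "1 \<le> i" "i < ?N" by auto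
      have zz: "\<exists>z'. z = z' + 2 \<and> 1 \<le> z' \<and> z' \<le> L" if "2 < z" "z < L + 3" using cs[of z] H that by auto
      from cs'[OF i] show "if odd i then P z < i else P z > i + 1"
      proof (elim disjE exE conjE)
        assume i: "i = 1"
        have e: "i + 1 = 2" using i by simp
        have False using H Q12 unfolding e by (auto simp: i)
        then show ?thesis ..
      next
        assume i: "i = 2"
        have e: "i + 1 = 1 + 2" using i by simp
        have q: "Q (i + 1) = Q1 L + 2" "Q i = 2" "Q1 L \<le> L" using Q12 Q1[of 1 L] I1[of L] L1 i unfolding e by auto
        with H have "2 < z" "z < L + 3" by auto
        then obtain z' where z': "z = z' + 2" "1 \<le> z'" "z' \<le> L" using zz by blast
        have "P1 z' \<noteq> L" using H q z' I1(5)[of z'] by auto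
        moreover have "P1 z' \<le> L" using I1 z' by auto
        ultimately have "P1 z' < L" by linarith
        then show ?thesis using P1[OF z'(2,3)] z'(1) i by auto
      next
        assume i: "i = L + 2"
        have e: "i + 1 = L + 3" using i by simp
        have q: "Q i = Q1 1 + 2" "Q (i + 1) = L + 3" "1 \<le> Q1 1" "Q1 1 \<le> L"
          using Q12 Q1[of L 1] I1[of 1] L1 i unfolding e by auto
        with H have "2 < z" "z < L + 3" by auto
        then obtain z' where z': "z = z' + 2" "1 \<le> z'" "z' \<le> L" using zz by blast
        have "P1 z' \<noteq> 1" using H q z' I1(5)[of z'] by auto
        moreover have "1 \<le> P1 z'" using I1 z' by auto
        ultimately have "1 < P1 z'" by linarith
        then show ?thesis using P1[OF z'(2,3)] z'(1) i L1 by auto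
      next
        assume i: "i = L + 3"
        have e: "i + 1 = L + 4" using i by simp
        have False using H Q12 unfolding e by (auto simp: i)
        then show ?thesis ..
      next
        fix i' assume i: "i = i' + 2" "1 \<le> i'" "i' < L"
        define j where "j = L - i'"
        have j: "i' + j = L" "1 \<le> j" "j < L" using i by (auto simp: j_def)
        have e: "i + 1 = i' + 1 + 2" using i by simp
        have q: "Q i = Q1 (j + 1) + 2" "Q (i + 1) = Q1 j + 2"
          using Q1[of i' "j + 1"] Q1[of "i' + 1" j] i j unfolding e by auto
        have r: "Q1 j \<le> L" "Q1 (j + 1) \<le> L" using I1[of j] I1[of "j + 1"] j by auto
        have "2 < z" "z < L + 3" using H q r by auto
        then obtain z' where z': "z = z' + 2" "1 \<le> z'" "z' \<le> L" using zz by blast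
        have o: "odd i \<longleftrightarrow> even j" using i(1) arg_cong[OF j(1), of even] L1 by auto
        have "if odd j then P1 z' < j else P1 z' > j + 1"
          using baxterD[OF b, of j z'] H j q z' by auto
        then show ?thesis using P1[OF z'(2,3)] z'(1) i(1) j o by (auto split: if_splits)
      qed
    qed
  qed
  show ?thesis unfolding leopard_def par bax zP zQ using inv inv1 by blast
qed

section \<open>Sums of permutations in one-line notation\<close>

lemma perms_iff: "p \<in> perms n \<longleftrightarrow> distinct p \<and> set p = {1..n}"
  by (auto simp: perms_def permutations_of_set_def)

lemma length_perms: "p \<in> perms n \<Longrightarrow> length p = n"
  by (auto simp: perms_iff dest: distinct_card)

lemma permsI:
  assumes "distinct xs" "set xs \<subseteq> {1..length xs}"
  shows "xs \<in> perms (length xs)"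
  using assms card_subset_eq[of "{1..length xs}" "set xs"] by (auto simp: perms_iff distinct_card)

lemma entry_in_set: "1 \<le> x \<Longrightarrow> x \<le> length p \<Longrightarrow> entry p x \<in> set p"
  by (auto simp: entry_def)

lemma length_perm_inverse: "length (perm_inverse p) = length p"
  by (simp add: perm_inverse_def del: upt_Suc)

text \<open>Connects the inverse given by a definite description with the functional inverse pairs.\<close>

lemma inverse_pair_perm_inverse:
  assumes p: "p \<in> perms N"
  shows "inverse_pair N (entry p) (entry (perm_inverse p))"
proof -
  have d: "distinct p" and s: "set p = {1..N}" and l: "length p = N"
    using p length_perms by (auto simp: perms_iff)
  have inj: "i = j" if "i \<in> {1..N}" "j \<in> {1..N}" "entry p i = entry p j" for i j
  proof -
    have "i - 1 = j - 1" using that d l by (subst nth_eq_iff_index_eq[symmetric, of p]) (auto simp: entry_def)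
    then show ?thesis using that by auto
  qed
  have q: "entry (perm_inverse p) v = (THE j. j \<in> {1..N} \<and> entry p j = v)" if "v \<in> {1..N}" for v
    using that l by (auto simp: perm_inverse_def entry_def simp del: upt_Suc)
  have th: "entry (perm_inverse p) (entry p j) = j" "entry p j \<in> {1..N}" if "j \<in> {1..N}" for j
  proof -
    show e: "entry p j \<in> {1..N}" using entry_in_set[of j p] that s l by auto
    show "entry (perm_inverse p) (entry p j) = j"
      unfolding q[OF e] by (rule the_equality) (use inj[OF _ that] that in blast)+
  qed
  have ex: "\<exists>j\<in>{1..N}. entry p j = v" if "v \<in> {1..N}" for v
  proof -
    from that s have "v \<in> set p" by simp
    then obtain i where "i < N" "p ! i = v" using l by (auto simp: in_set_conv_nth)
    then show ?thesis by (intro bexI[of _ "i + 1"]) (auto simp: entry_def)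
  qed
  show ?thesis unfolding inverse_pair_def
  proof
    fix x assume x: "x \<in> {1..N}"
    from ex[OF x] obtain j where "j \<in> {1..N}" "entry p j = x" by blast
    with th[OF this(1)] th[OF x] x show "entry p x \<in> {1..N} \<and> entry (perm_inverse p) x \<in> {1..N} \<and>
        entry (perm_inverse p) (entry p x) = x \<and> entry p (entry (perm_inverse p) x) = x" by auto
  qed
qed

definition direct_sum :: "nat list \<Rightarrow> nat list \<Rightarrow> nat list" (infixl "\<oplus>" 65) where
  "xs \<oplus> ys = xs @ map (\<lambda>v. v + length xs) ys"

definition skew_sum :: "nat list \<Rightarrow> nat list \<Rightarrow> nat list" (infixl "\<ominus>" 65) where
  "xs \<ominus> ys = map (\<lambda>v. v + length ys) xs @ ys"

lemma length_sums [simp]: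
  "length (xs \<oplus> ys) = length xs + length ys" "length (xs \<ominus> ys) = length xs + length ys"
  by (auto simp: direct_sum_def skew_sum_def)

lemma length_perm_complement [simp]: "length (perm_complement p) = length p"
  by (simp add: perm_complement_def)

lemma perm_complement_skew_sum:
  "set ys \<subseteq> {1..length ys} \<Longrightarrow> perm_complement (xs \<ominus> ys) = perm_complement xs \<oplus> perm_complement ys"
  by (auto simp: perm_complement_def skew_sum_def direct_sum_def)

lemma perm_complement_direct_sum:
  "set xs \<subseteq> {1..length xs} \<Longrightarrow> perm_complement (xs \<oplus> ys) = perm_complement xs \<ominus> perm_complement ys"
  by (auto simp: perm_complement_def skew_sum_def direct_sum_def)

lemma perm_complement_in_perms:
  assumes "p \<in> perms n" shows "perm_complement p \<in> perms n"
proof -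
  have l: "length p = n" using length_perms[OF assms] .
  have "perm_complement p \<in> perms (length (perm_complement p))"
  proof (rule permsI)
    have "inj_on (\<lambda>v. length p + 1 - v) (set p)" using assms l by (intro inj_onI) (auto simp: perms_iff)
    then show "distinct (perm_complement p)" using assms by (simp add: perm_complement_def distinct_map perms_iff)
  qed (use assms l in \<open>auto simp: perm_complement_def perms_iff\<close>)
  then show ?thesis by (simp add: l)
qed

lemma perm_complement_involutive:
  assumes "p \<in> perms n" shows "perm_complement (perm_complement p) = p"
proof -
  have "map (\<lambda>v. length p + 1 - (length p + 1 - v)) p = map (\<lambda>v. v) p"
    using assms length_perms[OF assms] by (intro map_cong) (auto simp: perms_iff)
  then show ?thesis by (simp add: perm_complement_def o_def)
qed

lemma direct_sum_in_perms:
  assumes "xs \<in> perms m" "ys \<in> perms n" shows "xs \<oplus> ys \<in> perms (m + n)"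
proof -
  have "xs \<oplus> ys \<in> perms (length (xs \<oplus> ys))"
    by (rule permsI)
      (use assms length_perms[OF assms(1)] length_perms[OF assms(2)] in
        \<open>auto simp: direct_sum_def perms_iff distinct_map\<close>)
  then show ?thesis using assms by (simp add: length_perms)
qed

lemma skew_sum_in_perms:
  assumes "xs \<in> perms m" "ys \<in> perms n" shows "xs \<ominus> ys \<in> perms (m + n)"
proof -
  have "xs \<ominus> ys \<in> perms (length (xs \<ominus> ys))"
    by (rule permsI)
      (use assms length_perms[OF assms(1)] length_perms[OF assms(2)] in
        \<open>auto simp: skew_sum_def perms_iff distinct_map\<close>)
  then show ?thesis using assms by (simp add: length_perms)
qed

section \<open>Recursive structure of the complete Baxter permutations\<close>

text \<open>These are the complete Baxter permutations behind the snow leopard permutations of odd length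
  (\<open>leopard_list_iff\<close>): a snow leopard permutation of length \<open>2d + 1\<close> comes from one of length
  \<open>4d + 3\<close>.\<close>

definition leopard_list :: "nat list \<Rightarrow> bool" where
  "leopard_list p \<longleftrightarrow> p \<in> perms (length p) \<and> length p mod 4 = 3 \<and>
     leopard (length p) (entry p) (entry (perm_inverse p))"

lemma leopard_list_skew_sum:
  assumes q: "q \<in> perms (length q)" "length q mod 4 = 3" and r: "r \<in> perms (length r)" "length r mod 4 = 3"
  shows "leopard_list (q \<ominus> [1] \<ominus> r) \<longleftrightarrow> leopard_list q \<and> leopard_list r"
proof -
  define L K where "L = length q" and "K = length r"
  let ?p = "q \<ominus> [1] \<ominus> r"
  have p: "?p = map (\<lambda>v. v + (K + 1)) q @ [K + 1] @ r" by (simp add: skew_sum_def L_def K_def)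
  have len: "length ?p = L + K + 1" by (simp add: L_def K_def)
  have "[1::nat] \<in> perms 1" by (simp add: perms_iff)
  then have pp: "?p \<in> perms (L + K + 1)" using skew_sum_in_perms[OF skew_sum_in_perms[OF q(1), of "[1]" 1] r(1)]
    by (simp add: L_def K_def add_ac)
  have "leopard (L + K + 1) (entry ?p) (entry (perm_inverse ?p)) \<longleftrightarrow>
     leopard L (entry q) (entry (perm_inverse q)) \<and> leopard K (entry r) (entry (perm_inverse r))"
  proof (rule leopard_skew)
    show "inverse_pair (L + K + 1) (entry ?p) (entry (perm_inverse ?p))"
      using pp by (rule inverse_pair_perm_inverse)
    show "inverse_pair L (entry q) (entry (perm_inverse q))"
      using q(1) unfolding L_def by (rule inverse_pair_perm_inverse)
    show "inverse_pair K (entry r) (entry (perm_inverse r))"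
      using r(1) unfolding K_def by (rule inverse_pair_perm_inverse)
    show "entry ?p x = entry q x + (K + 1)" if "1 \<le> x" "x \<le> L" for x
      using that unfolding p by (auto simp: entry_def nth_append L_def)
    show "entry ?p (L + 1) = K + 1"
      unfolding p by (auto simp: entry_def nth_append L_def)
    show "entry ?p (x + (L + 1)) = entry r x" if "1 \<le> x" "x \<le> K" for x
      using that unfolding p by (cases x) (auto simp: entry_def nth_append L_def)
  qed (use q r in \<open>simp_all add: L_def K_def\<close>)
  moreover have "(L + K + 1) mod 4 = 3" using q(2) r(2) unfolding L_def K_def by presburger
  ultimately show ?thesis using pp q r unfolding leopard_list_def len by (simp add: L_def K_def)
qed

text \<open>Width 2 occurs on complete Baxter permutations, width 1 on their odd threads.\<close>

definition frame :: "nat \<Rightarrow> nat list \<Rightarrow> nat list" where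
  "frame k p = increasing_perm k \<oplus> perm_complement p \<oplus> increasing_perm k"

lemma length_increasing_perm [simp]: "length (increasing_perm k) = k"
  by (simp add: increasing_perm_def del: upt_Suc)

lemma increasing_perm_in_perms: "increasing_perm k \<in> perms k"
  by (auto simp: perms_iff increasing_perm_def simp del: upt_Suc)

lemma length_frame [simp]: "length (frame k p) = length p + 2 * k"
  by (simp add: frame_def)

lemma frame_in_perms:
  assumes "p \<in> perms n"
  shows "frame k p \<in> perms (n + 2 * k)"
proof -
  have "frame k p \<in> perms (k + n + k)" unfolding frame_def
    by (intro direct_sum_in_perms increasing_perm_in_perms perm_complement_in_perms assms)
  moreover have "k + n + k = n + 2 * k" by simp
  ultimately show ?thesis by simp
qed

lemma frame_2:
  assumes "p \<in> perms L"
  shows "frame 2 p = [1, 2] @ map (\<lambda>v. L + 3 - v) p @ [L + 3, L + 4]"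
proof -
  have "increasing_perm 2 = [1, 2]" by (simp add: increasing_perm_def upt_rec)
  then show ?thesis using assms length_perms[OF assms]
    by (auto simp: frame_def direct_sum_def perm_complement_def perms_iff)
qed

lemma leopard_list_frame:
  assumes p: "p \<in> perms (length p)" "length p mod 4 = 3"
  shows "leopard_list (frame 2 p) \<longleftrightarrow> leopard_list p"
proof -
  define L where "L = length p"
  let ?q = "frame 2 p"
  have pL: "p \<in> perms L" using p by (simp add: L_def)
  note q = frame_2[OF pL]
  have len: "length ?q = L + 4" by (simp add: L_def)
  have pq: "?q \<in> perms (L + 4)" using frame_in_perms[OF pL, of 2] by simp
  have ent: "1 \<le> entry p x \<and> entry p x \<le> L" if "1 \<le> x" "x \<le> L" for x
    using entry_in_set[of x p] that pL by (auto simp: perms_iff L_def)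
  have "leopard (L + 4) (entry ?q) (entry (perm_inverse ?q)) \<longleftrightarrow> leopard L (entry p) (entry (perm_inverse p))"
  proof (rule leopard_frame)
    show "inverse_pair (L + 4) (entry ?q) (entry (perm_inverse ?q))"
      using pq by (rule inverse_pair_perm_inverse)
    show "inverse_pair L (entry p) (entry (perm_inverse p))"
      using pL by (rule inverse_pair_perm_inverse)
    show "entry ?q (x + 2) + entry p x = L + 3" if "1 \<le> x" "x \<le> L" for x
    proof -
      have "entry ?q (x + 2) = L + 3 - entry p x"
        using that unfolding q by (cases x) (auto simp: entry_def nth_append L_def)
      then show ?thesis using ent[OF that] by simp
    qed
  qed (use p in \<open>auto simp: q entry_def nth_append L_def\<close>)
  then show ?thesis using p pq unfolding leopard_list_def len by (simp add: L_def)
qed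

lemma leopard_list_123: "leopard_list [1, 2, 3]"
proof -
  have p: "[1, 2, 3] \<in> perms 3" by (auto simp: perms_iff)
  have e: "entry [1, 2, 3] x = x" if "1 \<le> x" "x \<le> 3" for x
  proof -
    have "x = 1 \<or> x = 2 \<or> x = 3" using that by linarith
    then show ?thesis by (auto simp: entry_def)
  qed
  note inv = inverse_pair_perm_inverse[OF p]
  have i: "entry (perm_inverse [1, 2, 3]) x = x" if "1 \<le> x" "x \<le> 3" for x
    using inverse_pair_eq[OF inv that e[OF that]] .
  have len: "length [1, 2, 3 :: nat] = 3" by simp
  have "zigzag 3 f" if "\<And>x. 1 \<le> x \<Longrightarrow> x \<le> 3 \<Longrightarrow> f x = x" for f
    unfolding zigzag_def
  proof (intro allI impI)
    fix i :: nat assume "1 \<le> i \<and> i < 3"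
    then have "i = 1 \<or> i = 2" by linarith
    then show "if i mod 4 = 1 \<or> i mod 4 = 2 then f i < f (i + 1) else f (i + 1) < f i"
      using that by auto
  qed
  moreover have "baxter 3 (entry [1, 2, 3]) (entry (perm_inverse [1, 2, 3]))"
    unfolding baxter_def using i by auto
  moreover have "same_parity 3 (entry [1, 2, 3])" unfolding same_parity_def using e by auto
  ultimately show ?thesis using p inv e i unfolding leopard_list_def leopard_def len by simp
qed

text \<open>The first summand of a skew sum is skew-indecomposable, either \<open>123\<close> or a frame; this turns the
  construction into that of binary trees.\<close>

inductive grown :: "nat list \<Rightarrow> bool" where
  start: "grown [1, 2, 3]"
| frame: "grown p \<Longrightarrow> grown (frame 2 p)"
| start_skew: "grown q \<Longrightarrow> grown ([1, 2, 3] \<ominus> [1] \<ominus> q)"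
| frame_skew: "grown p \<Longrightarrow> grown q \<Longrightarrow> grown (frame 2 p \<ominus> [1] \<ominus> q)"

lemma leopard_list_perms: "leopard_list p \<Longrightarrow> p \<in> perms (length p)"
  and leopard_list_mod_4: "leopard_list p \<Longrightarrow> length p mod 4 = 3"
  by (simp_all add: leopard_list_def)

lemma leopard_list_if_grown: "grown p \<Longrightarrow> leopard_list p"
proof (induction rule: grown.induct)
  case start
  show ?case by (rule leopard_list_123)
next
  case (frame p)
  then show ?case using leopard_list_frame leopard_list_perms leopard_list_mod_4 by blast
next
  case (start_skew q)
  then show ?case using leopard_list_skew_sum[of "[1, 2, 3]" q] leopard_list_123 leopard_list_perms leopard_list_mod_4
    by blast
next
  case (frame_skew p q)
  then have "leopard_list (frame 2 p)" using leopard_list_frame leopard_list_perms leopard_list_mod_4 by blast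
  then show ?case using frame_skew.IH leopard_list_skew_sum[of "frame 2 p" q] leopard_list_perms leopard_list_mod_4
    by blast
qed

text \<open>Once both corners are known to be \<open>12\<close>, the entries in between only have to be complemented and
  renumbered.\<close>

lemma leopard_list_starting_with_1:
  assumes p: "leopard_list p" and p1: "entry p 1 = 1"
  shows "p = [1, 2, 3] \<or> (\<exists>q. leopard_list q \<and> p = frame 2 q)"
proof -
  define N where "N = length p"
  define P where "P = entry p"
  have pp: "p \<in> perms N" and N: "N mod 4 = 3" and L: "leopard N P (entry (perm_inverse p))"
    using p by (auto simp: leopard_list_def N_def P_def)
  have inv: "inverse_pair N P (entry (perm_inverse p))" using L by (auto simp: leopard_def)
  have N3: "3 \<le> N" using N by (metis mod_less_eq_dividend)
  have P: "P 1 = 1" "P 2 = 2" "P N = N" "P (N - 1) = N - 1"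
    using leopard_corner[OF L N] leopard_second[OF L] leopard_penultimate[OF L N] p1 N3 by (auto simp: P_def)
  show ?thesis
  proof (cases "N = 3")
    case True
    have "p = [P 1, P 2, P 3]"
      by (rule nth_equalityI) (use True in \<open>auto simp: P_def N_def entry_def less_Suc_eq numeral_3_eq_3\<close>)
    then show ?thesis using P True by simp
  next
    case False
    obtain d where d: "N = 4 * d + 3" using N by (metis mult_div_mod_eq)
    with False have "d \<noteq> 0" by auto
    then obtain e where e: "d = Suc e" using not0_implies_Suc by auto
    define M where "M = 4 * e + 3"
    have NM: "N = M + 4" and M: "M mod 4 = 3" "1 \<le> M" using d e by (auto simp: M_def)
    define m where "m = take M (drop 2 p)"
    have lm: "length m = M" using NM by (simp add: m_def N_def)
    have pm: "p = [1, 2] @ m @ [M + 3, M + 4]"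
    proof (rule nth_equalityI)
      show "length p = length ([1, 2] @ m @ [M + 3, M + 4])" using lm NM by (simp add: N_def)
      fix i assume i: "i < length p"
      have pi: "p ! i = P (i + 1)" by (simp add: P_def entry_def)
      have "i < M + 4" using i NM by (simp add: N_def)
      then consider "i = 0" | "i = 1" | i' where "i = i' + 2" "i' < M" | "i = M + 2" | "i = M + 3"
      proof -
        have "i = 0 \<or> i = 1 \<or> (i = (i - 2) + 2 \<and> i - 2 < M) \<or> i = M + 2 \<or> i = M + 3"
          using \<open>i < M + 4\<close> by linarith
        then show ?thesis using that by metis
      qed
      then show "p ! i = ([1, 2] @ m @ [M + 3, M + 4]) ! i"
      proof cases
        case 1 then show ?thesis using P pi by simp
      next
        case 2 then show ?thesis using P pi by (simp add: numeral_2_eq_2)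
      next
        case (3 i')
        then show ?thesis using i lm by (simp add: nth_append m_def)
      next
        case 4
        then have e: "i + 1 = N - 1" using NM by simp
        have "p ! i = M + 3" using P(4) pi[unfolded e] NM by simp
        then show ?thesis using 4 lm by (simp add: nth_append)
      next
        case 5
        then have e: "i + 1 = N" using NM by simp
        have "p ! i = M + 4" using P(3) pi[unfolded e] NM by simp
        then show ?thesis using 5 lm by (simp add: nth_append)
      qed
    qed
    have dp: "distinct p" "set p = {1..M + 4}" using pp NM by (auto simp: perms_iff)
    have dm: "distinct m" using dp(1) by (subst (asm) pm) auto
    have sm: "set m \<subseteq> {3..M + 2}"
    proof
      fix v assume v: "v \<in> set m"
      then have "v \<in> {1..M + 4}" using dp(2) by (subst (asm) (1) pm) auto
      moreover have "v \<noteq> 1" "v \<noteq> 2" "v \<noteq> M + 3" "v \<noteq> M + 4" using v dp(1) by (subst (asm) pm, auto)+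
      ultimately show "v \<in> {3..M + 2}" by auto
    qed
    define q where "q = map (\<lambda>v. M + 3 - v) m"
    have lq: "length q = M" by (simp add: q_def lm)
    have qp: "q \<in> perms M"
    proof -
      have "q \<in> perms (length q)"
      proof (rule permsI)
        have "inj_on (\<lambda>v. M + 3 - v) (set m)"
        proof (rule inj_onI)
          fix v w assume "v \<in> set m" "w \<in> set m" "M + 3 - v = M + 3 - w"
          moreover from this have "v \<le> M + 2" "w \<le> M + 2" using sm by auto
          ultimately show "v = w" by linarith
        qed
        then show "distinct q" using dm by (simp add: q_def distinct_map)
        show "set q \<subseteq> {1..length q}"
        proof
          fix w assume "w \<in> set q"
          then obtain v where "v \<in> set m" "w = M + 3 - v" by (auto simp: q_def)
          moreover from this have "3 \<le> v" "v \<le> M + 2" using sm by auto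
          ultimately show "w \<in> {1..length q}" using lq by auto
        qed
      qed
      then show ?thesis by (simp add: lq)
    qed
    have "map (\<lambda>v. M + 3 - v) q = m"
    proof -
      have "map (\<lambda>v. M + 3 - (M + 3 - v)) m = map (\<lambda>v. v) m"
      proof (rule map_cong[OF refl])
        fix v assume "v \<in> set m"
        then have "v \<le> M + 2" using sm by auto
        then show "M + 3 - (M + 3 - v) = v" by linarith
      qed
      then show ?thesis by (simp add: q_def o_def)
    qed
    then have pf: "p = frame 2 q" using pm frame_2[OF qp] by simp
    then have "leopard_list q" using p leopard_list_frame[of q] qp lq M by simp
    with pf show ?thesis by blast
  qed
qed

text \<open>Here \<open>q\<close> consists of the entries that are at least \<open>p(1)\<close>, and \<open>r\<close> of those below
  \<open>p(1) - 1\<close>, which the winding argument puts on different sides of the entry \<open>p(1) - 1\<close>.\<close>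

lemma leopard_list_not_starting_with_1:
  assumes p: "leopard_list p" and p1: "entry p 1 \<noteq> 1"
  shows "\<exists>q r. leopard_list q \<and> entry q 1 = 1 \<and> leopard_list r \<and> p = q \<ominus> [1] \<ominus> r"
proof -
  define N where "N = length p"
  define P where "P = entry p"
  define Q where "Q = entry (perm_inverse p)"
  have pp: "p \<in> perms N" and N: "N mod 4 = 3" and L: "leopard N P Q"
    using p by (auto simp: leopard_list_def N_def P_def Q_def)
  have inv: "inverse_pair N P Q" using L by (auto simp: leopard_def)
  have N1: "1 \<le> N" "odd N" using N by presburger+
  have a: "P 1 mod 4 = 1" "1 < P 1" "P 1 \<le> N"
    using leopard_first_mod_4[OF L N1(1)] inverse_pairD[OF inv, of 1] N1 p1 by (auto simp: P_def)
  define k where "k = P 1 div 4"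
  have ak: "P 1 = 4 * k + 1" using a(1) mult_div_mod_eq[of 4 "P 1"] unfolding k_def by linarith
  define K where "K = P 1 - 2"
  define M where "M = N + 1 - P 1"
  have NK: "N = M + K + 1" "P 1 = K + 2" using a by (auto simp: K_def M_def)
  have K4: "K mod 4 = 3"
  proof -
    have "K = 4 * (k - 1) + 3" using ak a(2) NK by simp
    then show ?thesis by simp
  qed
  have M4: "M mod 4 = 3" using N NK(1) K4 by presburger
  have M1: "1 \<le> M" using M4 by (cases M) auto
  have y: "Q (K + 1) = M + 1" using leopard_split_position[OF L N1(2) a(2)] NK by simp
  have split: "Q v < M + 1 \<longleftrightarrow> K + 2 \<le> v" if "1 \<le> v" "v \<le> N" for v
    using leopard_split_at_first[OF L N1(2) a(2) that] y NK by simp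
  have big: "K + 2 \<le> P x \<and> P x \<le> N" if "1 \<le> x" "x \<le> M" for x
    using split[of "P x"] inverse_pairD[OF inv, of x] that NK by auto
  have mid: "P (M + 1) = K + 1" using inverse_pairD[OF inv, of "K + 1"] y NK by auto
  have small: "1 \<le> P x \<and> P x \<le> K" if "M + 1 < x" "x \<le> N" for x
  proof -
    have "P x \<noteq> K + 1" using inverse_pairD(5)[OF inv, of x] y that by auto
    then show ?thesis using split[of "P x"] inverse_pairD[OF inv, of x] that NK by auto
  qed
  define q where "q = map (\<lambda>v. v - (K + 1)) (take M p)"
  define r where "r = drop (M + 1) p"
  have lq: "length q = M" "length r = K" using NK by (auto simp: q_def r_def N_def)
  have tb: "K + 2 \<le> v \<and> v \<le> N" if "v \<in> set (take M p)" for v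
  proof -
    from that obtain i where "i < M" "v = p ! i" by (auto simp: in_set_conv_nth)
    then show ?thesis using big[of "i + 1"] by (auto simp: P_def entry_def)
  qed
  have p_eq: "p = q \<ominus> [1] \<ominus> r"
  proof -
    have "map (\<lambda>v. v - (K + 1) + (K + 1)) (take M p) = map (\<lambda>v. v) (take M p)"
      by (rule map_cong[OF refl]) (use tb in force)
    then have t: "map (\<lambda>v. v + (K + 1)) q = take M p" by (simp add: q_def o_def)
    have "M < length p" using NK by (simp add: N_def)
    then have "p = take M p @ p ! M # drop (Suc M) p" by (rule id_take_nth_drop)
    moreover have "p ! M = K + 1" using mid by (simp add: P_def entry_def)
    ultimately have "p = map (\<lambda>v. v + (K + 1)) q @ [K + 1] @ r" unfolding t by (simp add: r_def)
    also have "\<dots> = q \<ominus> [1] \<ominus> r" using lq by (simp add: skew_sum_def)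
    finally show ?thesis .
  qed
  have dp: "distinct p" using pp by (simp add: perms_iff)
  have "q \<in> perms (length q)"
  proof (rule permsI)
    have "inj_on (\<lambda>v. v - (K + 1)) (set (take M p))"
    proof (rule inj_onI)
      fix v w assume "v \<in> set (take M p)" "w \<in> set (take M p)" "v - (K + 1) = w - (K + 1)"
      then show "v = w" using tb[of v] tb[of w] by linarith
    qed
    then show "distinct q" using dp by (simp add: q_def distinct_map)
    show "set q \<subseteq> {1..length q}"
    proof
      fix w assume "w \<in> set q"
      then obtain v where "v \<in> set (take M p)" "w = v - (K + 1)" by (auto simp: q_def)
      then show "w \<in> {1..length q}" using tb[of v] NK lq by auto
    qed
  qed
  moreover have "r \<in> perms (length r)"
  proof (rule permsI)
    show "distinct r" using dp by (simp add: r_def)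
    show "set r \<subseteq> {1..length r}"
    proof
      fix v assume "v \<in> set r"
      then obtain i where i: "i < K" "v = r ! i" using lq by (auto simp: in_set_conv_nth)
      then have "v = P (M + 2 + i)" using NK by (simp add: r_def P_def entry_def N_def)
      then show "v \<in> {1..length r}" using small[of "M + 2 + i"] i NK lq by auto
    qed
  qed
  ultimately have "leopard_list q \<and> leopard_list r"
    using p leopard_list_skew_sum[of q r] lq K4 M4 unfolding p_eq[symmetric] by simp
  moreover have "entry q 1 = 1"
  proof -
    have "q ! 0 = p ! 0 - (K + 1)" using M1 NK by (simp add: q_def N_def)
    then show ?thesis using NK(2) by (simp add: entry_def P_def)
  qed
  ultimately show ?thesis using p_eq by blast
qed

lemma leopard_list_iff_grown: "leopard_list p \<longleftrightarrow> grown p"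
proof
  show "leopard_list p \<Longrightarrow> grown p"
  proof (induction p rule: length_induct)
    case (1 p)
    note IH = 1(1)[rule_format]
    have core: "q = [1, 2, 3] \<or> (\<exists>q'. grown q' \<and> q = frame 2 q')"
      if "leopard_list q" "entry q 1 = 1" "length q \<le> length p" for q
      using leopard_list_starting_with_1[OF that(1,2)]
    proof (elim disjE exE conjE)
      fix q' assume "leopard_list q'" "q = frame 2 q'"
      moreover from this have "length q' < length p" using that(3) by simp
      ultimately show ?thesis using IH by blast
    qed simp
    show "grown p"
    proof (cases "entry p 1 = 1")
      case True
      have "p = [1, 2, 3] \<or> (\<exists>q. grown q \<and> p = frame 2 q)" using core[OF 1(2) True] by blast
      then show ?thesis using grown.start grown.frame by blast
    next
      case False
      from leopard_list_not_starting_with_1[OF 1(2) this]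
      obtain q r where qr: "leopard_list q" "entry q 1 = 1" "leopard_list r" "p = q \<ominus> [1] \<ominus> r" by blast
      have l: "length q \<le> length p" "length r < length p" using qr(4) by simp_all
      have "grown r" using IH[OF l(2) qr(3)] .
      then show ?thesis using core[OF qr(1,2) l(1)] grown.start_skew grown.frame_skew unfolding qr(4)
        by blast
    qed
  qed
qed (rule leopard_list_if_grown)

section \<open>Snow leopard permutations and their threads\<close>

lemma filter_odd_of_alternating_parity:
  assumes "\<And>i. i < length p \<Longrightarrow> even (p ! i) \<longleftrightarrow> odd i"
  shows "filter odd p = map (\<lambda>j. p ! (2 * j)) [0..<(length p + 1) div 2]"
  using assms
proof (induction p rule: rev_induct)
  case Nil
  then show ?case by simp
next
  case (snoc a p)
  have "even (p ! i) \<longleftrightarrow> odd i" if "i < length p" for i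
    using snoc.prems[of i] that by (simp add: nth_append)
  then have IH: "filter odd p = map (\<lambda>j. p ! (2 * j)) [0..<(length p + 1) div 2]"
    using snoc.IH by auto
  have a: "even a \<longleftrightarrow> odd (length p)" using snoc.prems[of "length p"] by simp
  have old: "map (\<lambda>j. (p @ [a]) ! (2 * j)) [0..<(length p + 1) div 2] = map (\<lambda>j. p ! (2 * j)) [0..<(length p + 1) div 2]"
    by (auto simp: nth_append)
  show ?case
  proof (cases "even (length p)")
    case True
    then obtain k where k: "length p = 2 * k" by auto
    have "(length (p @ [a]) + 1) div 2 = Suc k" "(length p + 1) div 2 = k" using k by simp_all
    then show ?thesis using IH a True old k by (simp add: nth_append)
  next
    case False
    then obtain k where k: "length p = 2 * k + 1" by (auto elim: oddE)
    have "(length (p @ [a]) + 1) div 2 = Suc k" "(length p + 1) div 2 = Suc k" using k by simp_all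
    then show ?thesis using IH a False old k by (simp add: nth_append)
  qed
qed

lemma card_even_upto: "card {y \<in> {1..x}. even y} = x div 2"
proof -
  have "{y \<in> {1..x}. even y} = (\<lambda>k. 2 * k) ` {1..x div 2}" by (auto elim!: evenE)
  then show ?thesis by (simp add: card_image inj_on_def)
qed

lemma card_odd_upto: "card {y \<in> {1..x}. odd y} = (x + 1) div 2"
proof -
  have "{y \<in> {1..x}. odd y} = (\<lambda>k. 2 * k + 1) ` {..<(x + 1) div 2}" by (auto elim!: oddE)
  then show ?thesis by (simp add: card_image inj_on_def)
qed

lemma induced_even_eq:
  assumes "p \<in> perms n"
  shows "induced_even p = map (\<lambda>v. v div 2) (filter even p)"
proof -
  have "card {y \<in> set (filter even p). y \<le> x} = x div 2" if "x \<in> set (filter even p)" for x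
  proof -
    have "{y \<in> set (filter even p). y \<le> x} = {y \<in> {1..x}. even y}"
      using that assms by (auto simp: perms_iff)
    then show ?thesis by (simp only: card_even_upto)
  qed
  then show ?thesis unfolding induced_even_def standardize_def by (intro map_cong refl)
qed

lemma induced_odd_eq:
  assumes "p \<in> perms n"
  shows "induced_odd p = map (\<lambda>v. (v + 1) div 2) (filter odd p)"
proof -
  have "card {y \<in> set (filter odd p). y \<le> x} = (x + 1) div 2" if "x \<in> set (filter odd p)" for x
  proof -
    have "{y \<in> set (filter odd p). y \<le> x} = {y \<in> {1..x}. odd y}"
      using that assms by (auto simp: perms_iff)
    then show ?thesis by (simp only: card_odd_upto)
  qed
  then show ?thesis unfolding induced_odd_def standardize_def by (intro map_cong refl)
qed

lemma perms_of_inverse_pair: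
  assumes inv: "inverse_pair (length p) (entry p) Q"
  shows "p \<in> perms (length p)"
proof (rule permsI)
  have e: "p ! i = entry p (i + 1)" for i by (simp add: entry_def)
  show "distinct p" unfolding distinct_conv_nth
  proof (intro allI impI)
    fix i j assume "i < length p" "j < length p" "i \<noteq> j"
    then show "p ! i \<noteq> p ! j"
      using inverse_pairD(5)[OF inv, of "i + 1"] inverse_pairD(5)[OF inv, of "j + 1"] unfolding e by auto
  qed
  show "set p \<subseteq> {1..length p}"
  proof
    fix v assume "v \<in> set p"
    then obtain i where "i < length p" "v = p ! i" by (auto simp: in_set_conv_nth)
    then show "v \<in> {1..length p}"
      using inverse_pairD(1,2)[OF inv, of "i + 1"] unfolding e by auto
  qed
qed

text \<open>The permutation induced on the odd entries, given that they stand in the odd positions.\<close>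

definition halve :: "(nat \<Rightarrow> nat) \<Rightarrow> nat \<Rightarrow> nat" where
  "halve f j = (f (2 * j - 1) + 1) div 2"

text \<open>Inducing on the odd entries commutes with inversion, so double alternation can be read off
  from \<open>P\<close> and \<open>Q\<close>.\<close>

lemma inverse_pair_halve:
  assumes inv: "inverse_pair N P Q" and par: "same_parity N P" and M: "N = 2 * M - 1"
  shows "inverse_pair M (halve P) (halve Q)"
proof -
  have *: "halve P j \<in> {1..M} \<and> halve Q (halve P j) = j"
    if inv: "inverse_pair N P Q" and par: "same_parity N P" and j: "j \<in> {1..M}" for P Q j
  proof -
    have r: "1 \<le> 2 * j - 1" "2 * j - 1 \<le> N" using j M by auto
    have "odd (2 * j - 1)" using j by auto
    then have "odd (P (2 * j - 1))" using par r by (auto simp: same_parity_def)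
    then obtain k where k: "P (2 * j - 1) = 2 * k + 1" by (auto elim: oddE)
    then have h: "halve P j = k + 1" by (simp add: halve_def)
    have "2 * (k + 1) - 1 = P (2 * j - 1)" using k by simp
    then have "halve Q (halve P j) = (Q (P (2 * j - 1)) + 1) div 2" unfolding h by (simp only: halve_def)
    also have "\<dots> = j" using inverse_pairD(5)[OF inv r] j by simp
    finally show ?thesis using h k inverse_pairD(2)[OF inv r] M by auto
  qed
  show ?thesis unfolding inverse_pair_def
    using *[OF inv par] *[OF inverse_pair_sym[OF inv] same_parity_sym[OF inv par]] by blast
qed

lemma alternating_halve:
  assumes par: "same_parity N f" and M: "N = 2 * M - 1" "length r = M"
    and r: "\<And>j. 1 \<le> j \<Longrightarrow> j \<le> M \<Longrightarrow> entry r j = halve f j"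
  shows "alternating r \<longleftrightarrow>
    (\<forall>i. 1 \<le> i \<and> i + 2 \<le> N \<and> odd i \<longrightarrow> (if i mod 4 = 1 then f i < f (i + 2) else f (i + 2) < f i))"
proof -
  have eq: "(if odd j then entry r j < entry r (j + 1) else entry r j > entry r (j + 1)) \<longleftrightarrow>
      (if (2 * j - 1) mod 4 = 1 then f (2 * j - 1) < f (2 * j - 1 + 2) else f (2 * j - 1 + 2) < f (2 * j - 1))"
    if j: "1 \<le> j" "j < M" for j
  proof -
    have e: "2 * (j + 1) - 1 = 2 * j - 1 + 2" using j by simp
    have "2 * j - 1 \<in> {1..N}" "odd (2 * j - 1)" "2 * j - 1 + 2 \<in> {1..N}" "odd (2 * j - 1 + 2)"
      using j M by auto
    then have odd: "odd (f (2 * j - 1))" "odd (f (2 * j - 1 + 2))" using par unfolding same_parity_def by blast+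
    obtain k where k: "f (2 * j - 1) = 2 * k + 1" using odd(1) by (rule oddE)
    obtain l where l: "f (2 * j - 1 + 2) = 2 * l + 1" using odd(2) by (rule oddE)
    have rr: "entry r j = k + 1" "entry r (j + 1) = l + 1"
      using r[of j] r[of "j + 1"] j k l unfolding halve_def e by simp_all
    have m: "(2 * j - 1) mod 4 = 1 \<longleftrightarrow> odd j"
    proof (cases "odd j")
      case True
      then obtain d where "j = 2 * d + 1" by (auto elim: oddE)
      then have "2 * j - 1 = 4 * d + 1" by simp
      then show ?thesis using True by simp
    next
      case False
      then obtain d where "j = 2 * d" by auto
      then have "2 * j - 1 = 4 * (d - 1) + 3" using j by auto
      then show ?thesis using False by simp
    qed
    show ?thesis unfolding m rr k l by simp
  qed
  show ?thesis
  proof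
    assume a: "alternating r"
    show "\<forall>i. 1 \<le> i \<and> i + 2 \<le> N \<and> odd i \<longrightarrow> (if i mod 4 = 1 then f i < f (i + 2) else f (i + 2) < f i)"
    proof (intro allI impI)
      fix i assume i: "1 \<le> i \<and> i + 2 \<le> N \<and> odd i"
      then obtain k where k: "i = 2 * k + 1" by (auto elim: oddE)
      then have j: "1 \<le> k + 1" "k + 1 < M" "2 * (k + 1) - 1 = i" using i M by auto
      have "if odd (k + 1) then entry r (k + 1) < entry r (k + 1 + 1) else entry r (k + 1) > entry r (k + 1 + 1)"
        using a j M unfolding alternating_def by (meson atLeastLessThan_iff)
      then show "if i mod 4 = 1 then f i < f (i + 2) else f (i + 2) < f i"
        unfolding eq[OF j(1,2)] j(3) .
    qed
  next
    assume a: "\<forall>i. 1 \<le> i \<and> i + 2 \<le> N \<and> odd i \<longrightarrow> (if i mod 4 = 1 then f i < f (i + 2) else f (i + 2) < f i)"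
    show "alternating r" unfolding alternating_def
    proof
      fix j assume "j \<in> {1..<length r}"
      then have j: "1 \<le> j" "j < M" using M by auto
      have "1 \<le> 2 * j - 1 \<and> 2 * j - 1 + 2 \<le> N \<and> odd (2 * j - 1)" using j M by auto
      then show "if odd j then entry r j < entry r (j + 1) else entry r j > entry r (j + 1)"
        unfolding eq[OF j] using a by blast
    qed
  qed
qed

lemma complete_Baxter_iff:
  assumes p: "p \<in> perms N"
  shows "complete_Baxter p \<longleftrightarrow> odd N \<and> same_parity N (entry p) \<and> baxter N (entry p) (entry (perm_inverse p))"
proof -
  define P Q where "P = entry p" and "Q = entry (perm_inverse p)"
  have l: "length p = N" using length_perms[OF p] .
  have inv: "inverse_pair N P Q" unfolding P_def Q_def by (rule inverse_pair_perm_inverse[OF p])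
  have "(\<forall>x\<in>{1..N}. \<forall>y\<in>{1..N}. \<forall>z\<in>{1..N}. \<forall>i.
        P x = i \<and> P y = i + 1 \<and> (x < z \<and> z < y \<or> y < z \<and> z < x) \<longrightarrow>
          (odd i \<longrightarrow> P z < i) \<and> (even i \<longrightarrow> P z > i + 1)) \<longleftrightarrow> baxter N P Q" (is "?L \<longleftrightarrow> _")
  proof
    assume a: ?L
    show "baxter N P Q" unfolding baxter_def
    proof (intro allI impI)
      fix i z
      assume H: "1 \<le> i \<and> i < N \<and> 1 \<le> z \<and> z \<le> N \<and>
        (Q i < z \<and> z < Q (i + 1) \<or> Q (i + 1) < z \<and> z < Q i)"
      have x: "Q i \<in> {1..N}" "P (Q i) = i" "Q (i + 1) \<in> {1..N}" "P (Q (i + 1)) = i + 1" "z \<in> {1..N}"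
        using inverse_pairD[OF inv, of i] inverse_pairD[OF inv, of "i + 1"] H by auto
      show "if odd i then P z < i else P z > i + 1"
        using a[rule_format, OF x(1,3,5), of i] x H by simp
    qed
  next
    assume b: "baxter N P Q"
    show ?L
    proof (intro ballI allI impI)
      fix x y z i
      assume H: "x \<in> {1..N}" "y \<in> {1..N}" "z \<in> {1..N}"
        "P x = i \<and> P y = i + 1 \<and> (x < z \<and> z < y \<or> y < z \<and> z < x)"
      have "Q i = x" "Q (i + 1) = y" using inverse_pair_eq[OF inv] H by auto
      moreover have "1 \<le> i" "i < N" using inverse_pairD[OF inv, of x] inverse_pairD[OF inv, of y] H by auto
      ultimately have "if odd i then P z < i else P z > i + 1" using baxterD[OF b, of i z] H by auto
      then show "(odd i \<longrightarrow> P z < i) \<and> (even i \<longrightarrow> P z > i + 1)" by (cases "odd i") simp_all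
    qed
  qed
  then show ?thesis using p unfolding complete_Baxter_def same_parity_def l P_def Q_def by blast
qed

lemma leopard_list_iff:
  "leopard_list p \<longleftrightarrow> complete_Baxter p \<and> length p mod 4 = 3 \<and> doubly_alternating (induced_odd p)"
proof (cases "p \<in> perms (length p) \<and> length p mod 4 = 3 \<and> complete_Baxter p")
  case True
  define N where "N = length p"
  define P Q where "P = entry p" and "Q = entry (perm_inverse p)"
  have p: "p \<in> perms N" and N4: "N mod 4 = 3" using True by (auto simp: N_def)
  have inv: "inverse_pair N P Q" unfolding P_def Q_def by (rule inverse_pair_perm_inverse[OF p])
  have N: "odd N" and par: "same_parity N P" and bax: "baxter N P Q"
    using True complete_Baxter_iff[OF p] by (auto simp: P_def Q_def)
  define M where "M = (N + 1) div 2"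
  have M: "N = 2 * M - 1" "1 \<le> M" using N by (auto simp: M_def elim!: oddE)
  define r where "r = induced_odd p"
  have alt: "even (p ! i) \<longleftrightarrow> odd i" if "i < length p" for i
    using par that by (auto simp: same_parity_def P_def N_def entry_def dest: bspec[of _ _ "i + 1"])
  have fo: "filter odd p = map (\<lambda>j. p ! (2 * j)) [0..<(length p + 1) div 2]"
    by (rule filter_odd_of_alternating_parity) (rule alt)
  have r: "r = map (\<lambda>j. (p ! (2 * j) + 1) div 2) [0..<M]"
    unfolding r_def induced_odd_eq[OF p] fo by (simp add: M_def N_def)
  have lr: "length r = M" by (simp add: r)
  have re: "entry r j = halve P j" if "1 \<le> j" "j \<le> M" for j
  proof -
    have "2 * (j - 1) = 2 * j - 1 - 1" "j - 1 < M" using that by simp_all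
    then show ?thesis using that unfolding r P_def halve_def entry_def by simp
  qed
  have invr: "inverse_pair M (halve P) (halve Q)" by (rule inverse_pair_halve[OF inv par M(1)])
  then have "inverse_pair M (entry r) (halve Q)" using re unfolding inverse_pair_def by auto
  then have rp: "r \<in> perms M" using perms_of_inverse_pair[of r] lr by auto
  have qe: "entry (perm_inverse r) v = halve Q v" if v: "1 \<le> v" "v \<le> M" for v
  proof (rule inverse_pair_eq[OF inverse_pair_perm_inverse[OF rp]])
    show "1 \<le> halve Q v" "halve Q v \<le> M" using inverse_pairD[OF invr v] by auto
    then show "entry r (halve Q v) = v" using re inverse_pairD[OF invr v] by auto
  qed
  have lq: "length (perm_inverse r) = M" by (simp add: length_perm_inverse lr)
  have aP: "alternating r \<longleftrightarrow>
      (\<forall>i. 1 \<le> i \<and> i + 2 \<le> N \<and> odd i \<longrightarrow> (if i mod 4 = 1 then P i < P (i + 2) else P (i + 2) < P i))"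
    by (rule alternating_halve[OF par M(1) lr]) (rule re)
  have aQ: "alternating (perm_inverse r) \<longleftrightarrow>
      (\<forall>i. 1 \<le> i \<and> i + 2 \<le> N \<and> odd i \<longrightarrow> (if i mod 4 = 1 then Q i < Q (i + 2) else Q (i + 2) < Q i))"
    by (rule alternating_halve[OF same_parity_sym[OF inv par] M(1) lq]) (rule qe)
  have "doubly_alternating r \<longleftrightarrow> zigzag N P \<and> zigzag N Q"
  proof
    assume d: "doubly_alternating r"
    have "zigzag N P"
      by (rule zigzag_of_odd_alternation[OF inverse_pair_sym[OF inv] baxter_inverse[OF inv par bax] N])
        (use d aP in \<open>auto simp: doubly_alternating_def\<close>)
    moreover have "zigzag N Q"
      by (rule zigzag_of_odd_alternation[OF inv bax N]) (use d aQ in \<open>auto simp: doubly_alternating_def\<close>)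
    ultimately show "zigzag N P \<and> zigzag N Q" ..
  next
    assume z: "zigzag N P \<and> zigzag N Q"
    have *: "if i mod 4 = 1 then f i < f (i + 2) else f (i + 2) < f i"
      if z: "zigzag N f" and i: "1 \<le> i \<and> i + 2 \<le> N \<and> odd i" for f i
    proof -
      have m: "i mod 4 = 1 \<and> (i + 1) mod 4 = 2 \<or> i mod 4 = 3 \<and> (i + 1) mod 4 = 0" using i by presburger
      have e: "i + 1 + 1 = i + 2" by simp
      have "1 \<le> i" "i < N" "1 \<le> i + 1" "i + 1 < N" using i by auto
      from zigzagD[OF z this(1,2)] zigzagD[OF z this(3,4)] m show ?thesis unfolding e by auto
    qed
    show "doubly_alternating r" unfolding doubly_alternating_def aP aQ
      by (intro conjI allI impI; rule *) (use z in auto)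
  qed
  then show ?thesis using True inv par bax
    unfolding leopard_list_def leopard_def r_def P_def Q_def N_def by blast
next
  case False
  have o: "length p mod 4 = 3 \<Longrightarrow> odd (length p)" by presburger
  have "\<not> leopard_list p"
    using False o complete_Baxter_iff[of p "length p"] unfolding leopard_list_def leopard_def by blast
  moreover have "complete_Baxter p \<Longrightarrow> p \<in> perms (length p)" unfolding complete_Baxter_def by blast
  ultimately show ?thesis using False by blast
qed

text \<open>The even and the odd thread, read off directly from the complete Baxter permutation: the
  entries \<open>v\<close> of the snow leopard permutation come from the entries \<open>2v\<close>.\<close>

definition quarter_even :: "nat list \<Rightarrow> nat list" where
  "quarter_even p = map (\<lambda>v. v div 4) (filter (\<lambda>v. v mod 4 = 0) p)"

definition quarter_odd :: "nat list \<Rightarrow> nat list" where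
  "quarter_odd p = map (\<lambda>v. (v + 2) div 4) (filter (\<lambda>v. v mod 4 = 2) p)"

lemma induced_even_perms:
  assumes p: "p \<in> perms n"
  shows "induced_even p \<in> perms (n div 2)"
proof -
  have s: "set p = {1..n}" "distinct p" using p by (auto simp: perms_iff)
  have "set (induced_even p) = {1..n div 2}"
  proof -
    have "(\<lambda>v. v div 2) ` {v \<in> {1..n}. even v} = {1..n div 2}"
    proof (intro set_eqI iffI)
      fix w assume "w \<in> {1..n div 2}"
      then show "w \<in> (\<lambda>v. v div 2) ` {v \<in> {1..n}. even v}" by (intro image_eqI[of _ _ "2 * w"]) auto
    qed (auto elim!: evenE)
    then show ?thesis unfolding induced_even_eq[OF p] using s by simp
  qed
  moreover have "inj_on (\<lambda>v. v div 2) (set (filter even p))"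
    by (rule inj_onI) (auto elim!: evenE)
  ultimately show ?thesis using s unfolding perms_iff induced_even_eq[OF p] by (simp add: distinct_map)
qed

lemma induced_of_induced_even:
  assumes p: "p \<in> perms n"
  shows "induced_even (induced_even p) = quarter_even p" "induced_odd (induced_even p) = quarter_odd p"
proof -
  have m: "even v \<and> even (v div 2) \<longleftrightarrow> v mod 4 = 0" "even v \<and> odd (v div 2) \<longleftrightarrow> v mod 4 = 2" for v :: nat
    by presburger+
  have d: "v mod 4 = 2 \<Longrightarrow> (v div 2 + 1) div 2 = (v + 2) div 4" for v :: nat
  proof -
    assume "v mod 4 = 2"
    then have "v = 4 * (v div 4) + 2" using mult_div_mod_eq[of 4 v] by simp
    then obtain e where "v = 4 * e + 2" by blast
    then show ?thesis by simp
  qed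
  show "induced_even (induced_even p) = quarter_even p"
    unfolding quarter_even_def
    by (subst induced_even_eq[OF induced_even_perms[OF p]], subst induced_even_eq[OF p])
      (simp add: filter_map o_def m div_mult2_eq[symmetric] conj_commute)
  show "induced_odd (induced_even p) = quarter_odd p"
    unfolding quarter_odd_def
    by (subst induced_odd_eq[OF induced_even_perms[OF p]], subst induced_even_eq[OF p])
      (auto simp: filter_map o_def m d intro!: map_cong)
qed

lemma snow_leopard_odd_iff:
  "snow_leopard (Perm s) \<and> odd (length s) \<longleftrightarrow> (\<exists>p. leopard_list p \<and> induced_even p = s)"
proof
  assume s: "snow_leopard (Perm s) \<and> odd (length s)"
  then obtain p where p: "p \<in> perms (2 * length s + 1)" "complete_Baxter p" "induced_even p = s"
    "doubly_alternating (induced_odd p)" by auto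
  have "(2 * length s + 1) mod 4 = 3" using conjunct2[OF s] by presburger
  then have "length p mod 4 = 3" using length_perms[OF p(1)] by simp
  then show "\<exists>p. leopard_list p \<and> induced_even p = s" using p leopard_list_iff by blast
next
  assume "\<exists>p. leopard_list p \<and> induced_even p = s"
  then obtain p where p: "leopard_list p" "induced_even p = s" by blast
  define N where "N = length p"
  have N4: "N mod 4 = 3" and pp: "p \<in> perms N" using p by (auto simp: leopard_list_def N_def)
  have sp: "s \<in> perms (N div 2)" using induced_even_perms[OF pp] p by simp
  then have ls: "length s = N div 2" by (rule length_perms)
  have "odd (N div 2)" "2 * (N div 2) + 1 = N" using N4 by presburger+
  then show "snow_leopard (Perm s) \<and> odd (length s)"
    using p(2) pp sp leopard_list_iff[of p] p(1) unfolding snow_leopard.simps ls by auto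
qed

text \<open>A witness of entanglement also shows that both sides are threads, so the thread conditions are
  absorbed, and the antipermutation contributes a single pair.\<close>

lemma entangled_iff:
  "entangled a b \<longleftrightarrow> a = Anti \<and> b = Perm [] \<or>
     (\<exists>p. grown p \<and> a = Perm (quarter_even p) \<and> b = Perm (quarter_odd p))"
proof -
  have "entangled a b \<longleftrightarrow> (\<exists>p. snow_leopard p \<and> odd (xlength p) \<and> even_part p = a \<and> odd_part p = b)"
    unfolding entangled_def even_thread_def odd_thread_def by blast
  also have "\<dots> \<longleftrightarrow> a = Anti \<and> b = Perm [] \<or>
      (\<exists>s. (snow_leopard (Perm s) \<and> odd (length s)) \<and> Perm (induced_even s) = a \<and> Perm (induced_odd s) = b)"
  proof -
    have "(\<exists>x. Q x) \<longleftrightarrow> Q Anti \<or> (\<exists>s. Q (Perm s))" for Q by (metis xperm.exhaust)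
    then show ?thesis by (auto simp del: snow_leopard.simps(2))
  qed
  also have "\<dots> \<longleftrightarrow> a = Anti \<and> b = Perm [] \<or>
     (\<exists>p. leopard_list p \<and> Perm (induced_even (induced_even p)) = a \<and> Perm (induced_odd (induced_even p)) = b)"
    unfolding snow_leopard_odd_iff by blast
  also have "\<dots> \<longleftrightarrow> a = Anti \<and> b = Perm [] \<or>
     (\<exists>p. leopard_list p \<and> a = Perm (quarter_even p) \<and> b = Perm (quarter_odd p))"
    using induced_of_induced_even leopard_list_perms by metis
  finally show ?thesis unfolding leopard_list_iff_grown .
qed

section \<open>Threads under the recursion\<close>

text \<open>The middle entry \<open>4(d + 1)\<close> of \<open>q \<ominus> 1 \<ominus> r\<close> is divisible by 4, so it reappears in the even
  thread and disappears from the odd one.\<close>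

lemma quarter_skew_sum:
  assumes "length r = 4 * d + 3" "length (quarter_even r) = d" "length (quarter_odd r) = d + 1"
  shows "quarter_even (q \<ominus> [1] \<ominus> r) = quarter_even q \<ominus> [1] \<ominus> quarter_even r"
    and "quarter_odd (q \<ominus> [1] \<ominus> r) = quarter_odd q \<ominus> quarter_odd r"
proof -
  have p: "q \<ominus> [1] \<ominus> r = map (\<lambda>v. v + 4 * (d + 1)) q @ [4 * (d + 1)] @ r"
    using assms(1) by (simp add: skew_sum_def)
  have m: "(v + 4 * (d + 1)) mod 4 = v mod 4" "(v + 4 * (d + 1)) div 4 = v div 4 + (d + 1)"
    "(v + 4 * (d + 1) + 2) div 4 = (v + 2) div 4 + (d + 1)"
    "(4 * (d + 1)) mod 4 = 0" "(4 * (d + 1)) div 4 = d + 1" for v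
    by presburger+
  have m': "Suc (Suc (v + 4 * Suc d)) div 4 = Suc (Suc (Suc v) div 4 + d)" for v
    by presburger
  show "quarter_even (q \<ominus> [1] \<ominus> r) = quarter_even q \<ominus> [1] \<ominus> quarter_even r"
    unfolding p quarter_even_def using assms(2)
    by (simp add: filter_map o_def m skew_sum_def quarter_even_def del: mult_Suc_right)
  show "quarter_odd (q \<ominus> [1] \<ominus> r) = quarter_odd q \<ominus> quarter_odd r"
    unfolding p quarter_odd_def using assms(3)
    by (simp add: filter_map o_def m m' skew_sum_def quarter_odd_def del: mult_Suc_right)
qed

text \<open>Complementing and shifting by 2 exchanges the residues 0 and 2 modulo 4, hence the two threads.
  Of the four new entries only 2 and \<open>4d + 6\<close> are even; both go to the odd thread.\<close>

lemma quarter_frame: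
  assumes p: "p \<in> perms (4 * d + 3)"
    and "length (quarter_even p) = d" "length (quarter_odd p) = d + 1"
  shows "quarter_even (frame 2 p) = perm_complement (quarter_odd p)"
    and "quarter_odd (frame 2 p) = frame 1 (quarter_even p)"
proof -
  let ?c = "\<lambda>v. 4 * d + 6 - v"
  have f: "frame 2 p = [1, 2] @ map ?c p @ [4 * d + 6, 4 * d + 7]"
    using frame_2[OF p] by (simp add: numeral_eq_Suc)
  have v: "v \<le> 4 * d + 3" if "v \<in> set p" for v using p that by (auto simp: perms_iff)
  have m0: "?c v mod 4 = 0 \<longleftrightarrow> v mod 4 = 2" "?c v mod 4 = 2 \<longleftrightarrow> v mod 4 = 0" if "v \<in> set p" for v
  proof -
    define w where "w = ?c v"
    have "w + v = 4 * d + 6" using v[OF that] by (simp add: w_def)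
    then have "w mod 4 = 0 \<longleftrightarrow> v mod 4 = 2" "w mod 4 = 2 \<longleftrightarrow> v mod 4 = 0" by presburger+
    then show "?c v mod 4 = 0 \<longleftrightarrow> v mod 4 = 2" "?c v mod 4 = 2 \<longleftrightarrow> v mod 4 = 0" by (simp_all add: w_def)
  qed
  have d2: "?c v div 4 = d + 1 + 1 - (v + 2) div 4" if "v \<in> set p" "v mod 4 = 2" for v
  proof -
    define e where "e = v div 4"
    have e: "v = 4 * e + 2" using that(2) mult_div_mod_eq[of 4 v] by (simp add: e_def)
    have "?c v = 4 * (d + 1 - e)" using e by simp
    moreover have "(v + 2) div 4 = e + 1" using e by simp
    ultimately show ?thesis by simp
  qed
  have d0: "(?c v + 2) div 4 = (d + 1 - v div 4) + 1" if "v \<in> set p" "v mod 4 = 0" for v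
  proof -
    define e where "e = v div 4"
    have e: "v = 4 * e" using that(2) mult_div_mod_eq[of 4 v] by (simp add: e_def)
    have "e \<le> d" using v[OF that(1)] e by simp
    then have "?c v + 2 = 4 * ((d + 1 - e) + 1)" using e by simp
    then show ?thesis unfolding e_def[symmetric] by (simp only: nonzero_mult_div_cancel_left)
  qed
  have fl: "filter (\<lambda>v. v mod 4 = 0) (map ?c p) = map ?c (filter (\<lambda>v. v mod 4 = 2) p)"
    "filter (\<lambda>v. v mod 4 = 2) (map ?c p) = map ?c (filter (\<lambda>v. v mod 4 = 0) p)"
    unfolding filter_map by (rule arg_cong[of _ _ "map ?c"], rule filter_cong[OF refl], simp only: o_def m0)+
  have l: "(4 * d + 6) mod 4 = 2" "(4 * d + 7) mod 4 = 3" "(4 * d + 6 + 2) div 4 = d + 2" by presburger+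
  have "quarter_even (frame 2 p) = map (\<lambda>v. v div 4) (filter (\<lambda>v. v mod 4 = 0) (map ?c p))"
    unfolding quarter_even_def f using l by simp
  also have "\<dots> = map (\<lambda>v. d + 1 + 1 - (v + 2) div 4) (filter (\<lambda>v. v mod 4 = 2) p)"
    unfolding fl map_map o_def by (rule map_cong) (use d2 in auto)
  also have "\<dots> = perm_complement (quarter_odd p)"
    unfolding perm_complement_def assms(3) by (simp add: quarter_odd_def o_def)
  finally show "quarter_even (frame 2 p) = perm_complement (quarter_odd p)" .
  have "quarter_odd (frame 2 p) = [1] @ map (\<lambda>v. (v + 2) div 4) (filter (\<lambda>v. v mod 4 = 2) (map ?c p)) @ [d + 2]"
    unfolding quarter_odd_def f using l by simp
  also have "map (\<lambda>v. (v + 2) div 4) (filter (\<lambda>v. v mod 4 = 2) (map ?c p)) =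
      map (\<lambda>v. (d + 1 - v div 4) + 1) (filter (\<lambda>v. v mod 4 = 0) p)"
    unfolding fl map_map o_def by (rule map_cong) (use d0 in auto)
  also have "\<dots> = map (\<lambda>v. v + 1) (perm_complement (quarter_even p))"
    unfolding perm_complement_def assms(2) by (simp add: quarter_even_def o_def)
  finally show "quarter_odd (frame 2 p) = frame 1 (quarter_even p)"
    using assms(2) by (simp add: frame_def direct_sum_def increasing_perm_def)
qed

lemma grown_quarters:
  assumes "grown p"
  shows "\<exists>d. length p = 4 * d + 3 \<and> quarter_even p \<in> perms d \<and> quarter_odd p \<in> perms (d + 1)"
  using assms
proof (induction rule: grown.induct)
  case start
  show ?case by (auto simp: quarter_even_def quarter_odd_def perms_iff)
next
  case (frame p)
  then obtain d where d: "length p = 4 * d + 3" "quarter_even p \<in> perms d" "quarter_odd p \<in> perms (d + 1)" by blast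
  have "p \<in> perms (4 * d + 3)" using leopard_list_perms[OF leopard_list_if_grown[OF frame.hyps]] d(1) by simp
  note q = quarter_frame[OF this length_perms[OF d(2)] length_perms[OF d(3)]]
  show ?case unfolding q using frame_in_perms[OF d(2), of 1] perm_complement_in_perms[OF d(3)] d(1)
    by (intro exI[of _ "d + 1"]) simp
next
  case (start_skew q)
  then obtain d where d: "length q = 4 * d + 3" "quarter_even q \<in> perms d" "quarter_odd q \<in> perms (d + 1)" by blast
  have s: "quarter_even [1, 2, 3] \<in> perms 0" "quarter_odd [1, 2, 3] \<in> perms 1" "[1 :: nat] \<in> perms 1"
    by (auto simp: quarter_even_def quarter_odd_def perms_iff)
  note q = quarter_skew_sum[OF d(1) length_perms[OF d(2)] length_perms[OF d(3)]]
  show ?case unfolding q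
    using skew_sum_in_perms[OF skew_sum_in_perms[OF s(1,3)] d(2)] skew_sum_in_perms[OF s(2) d(3)] d(1)
    by (intro exI[of _ "d + 1"]) simp
next
  case (frame_skew p q)
  then obtain d e where d: "length p = 4 * d + 3" "quarter_even p \<in> perms d" "quarter_odd p \<in> perms (d + 1)"
    and e: "length q = 4 * e + 3" "quarter_even q \<in> perms e" "quarter_odd q \<in> perms (e + 1)" by blast
  have "p \<in> perms (4 * d + 3)" using leopard_list_perms[OF leopard_list_if_grown[OF frame_skew.hyps(1)]] d(1) by simp
  note f = quarter_frame[OF this length_perms[OF d(2)] length_perms[OF d(3)]]
  note q = quarter_skew_sum[OF e(1) length_perms[OF e(2)] length_perms[OF e(3)]]
  have s: "[1 :: nat] \<in> perms 1" by (auto simp: perms_iff)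
  show ?case unfolding q f
    using skew_sum_in_perms[OF skew_sum_in_perms[OF perm_complement_in_perms[OF d(3)] s] e(2)]
      skew_sum_in_perms[OF frame_in_perms[OF d(2), of 1] e(3)] d(1) e(1)
    by (intro exI[of _ "d + 2 + e"]) (simp add: algebra_simps)
qed

section \<open>Avoiding 3412 among involutions\<close>

text \<open>The recursion of Motzkin paths, read on involutions: the point 1 is fixed, or it is exchanged
  with \<open>k\<close>, and then the first \<open>k\<close> points form a block.\<close>

inductive motzkin :: "nat list \<Rightarrow> bool" where
  empty: "motzkin []"
| fixed: "motzkin r \<Longrightarrow> motzkin ([1] \<oplus> r)"
| arch: "motzkin t \<Longrightarrow> motzkin r \<Longrightarrow> motzkin ([1] \<ominus> t \<ominus> [1] \<oplus> r)"

text \<open>Positions instead of subsequences: in this form the pattern can be traced through sums by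
  arithmetic on positions.\<close>

definition has_3412 :: "nat list \<Rightarrow> bool" where
  "has_3412 s \<longleftrightarrow> (\<exists>w x y z. w < x \<and> x < y \<and> y < z \<and> z < length s \<and>
     s ! y < s ! z \<and> s ! z < s ! w \<and> s ! w < s ! x)"

text \<open>The standardized entry of \<open>x\<close> counts the entries up to \<open>x\<close> and so is weakly monotone in \<open>x\<close>;
  distinct counts therefore reveal the order.\<close>

lemma standardize_3412_iff:
  "standardize xs = [3, 4, 1, 2] \<longleftrightarrow> (\<exists>a b c d. xs = [a, b, c, d] \<and> c < d \<and> d < a \<and> a < b)"
proof
  assume s: "standardize xs = [3, 4, 1, 2]"
  have "length (standardize xs) = length xs" by (simp add: standardize_def)
  then have "length xs = 4" using s by simp
  then obtain a b c d where xs: "xs = [a, b, c, d]"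
    by (auto simp: numeral_eq_Suc length_Suc_conv)
  define f where "f x = card {y \<in> set xs. y \<le> x}" for x
  have f: "f a = 3" "f b = 4" "f c = 1" "f d = 2"
    using s unfolding xs standardize_def f_def by auto
  have less: "x < y" if "f x < f y" for x y
  proof (rule ccontr)
    assume "\<not> x < y"
    then have "{z \<in> set xs. z \<le> y} \<subseteq> {z \<in> set xs. z \<le> x}" by auto
    then have "f y \<le> f x" unfolding f_def by (intro card_mono) auto
    with that show False by simp
  qed
  have "c < d \<and> d < a \<and> a < b" using less[of c d] less[of d a] less[of a b] f by simp
  with xs show "\<exists>a b c d. xs = [a, b, c, d] \<and> c < d \<and> d < a \<and> a < b" by blast
next
  assume "\<exists>a b c d. xs = [a, b, c, d] \<and> c < d \<and> d < a \<and> a < b"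
  then obtain a b c d where xs: "xs = [a, b, c, d]" and o: "c < d" "d < a" "a < b" by blast
  have "{y \<in> set xs. y \<le> a} = {a, c, d}" "{y \<in> set xs. y \<le> b} = {a, b, c, d}"
    "{y \<in> set xs. y \<le> c} = {c}" "{y \<in> set xs. y \<le> d} = {c, d}" using xs o by auto
  then show "standardize xs = [3, 4, 1, 2]" using o unfolding standardize_def xs
    by (simp add: card_insert_if)
qed

lemma avoids_3412_iff: "avoids s [3, 4, 1, 2] \<longleftrightarrow> \<not> has_3412 s"
proof -
  have "(\<exists>xs. subseq xs s \<and> standardize xs = [3, 4, 1, 2]) \<longleftrightarrow> has_3412 s"
  proof
    assume "\<exists>xs. subseq xs s \<and> standardize xs = [3, 4, 1, 2]"
    then obtain a b c d where sub: "subseq [a, b, c, d] s" and o: "c < d" "d < a" "a < b"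
      unfolding standardize_3412_iff by blast
    from sub obtain s0 s1 s2 s3 r where s: "s = s0 @ a # s1 @ b # s2 @ c # s3 @ d # r"
      by (auto dest!: list_emb_ConsD)
    let ?w = "length s0" and ?x = "length (s0 @ a # s1)" and ?y = "length (s0 @ a # s1 @ b # s2)"
      and ?z = "length (s0 @ a # s1 @ b # s2 @ c # s3)"
    have n: "s ! ?w = a" unfolding s by (rule nth_append_length)
    have "s = (s0 @ a # s1) @ b # s2 @ c # s3 @ d # r" "s = (s0 @ a # s1 @ b # s2) @ c # s3 @ d # r"
      "s = (s0 @ a # s1 @ b # s2 @ c # s3) @ d # r" using s by simp_all
    then have "s ! ?x = b" "s ! ?y = c" "s ! ?z = d" by (metis nth_append_length)+
    moreover have "?w < ?x" "?x < ?y" "?y < ?z" "?z < length s" unfolding s by simp_all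
    ultimately show "has_3412 s" unfolding has_3412_def using n o by metis
  next
    assume "has_3412 s"
    then obtain w x y z where i: "w < x" "x < y" "y < z" "z < length s"
      and o: "s ! y < s ! z" "s ! z < s ! w" "s ! w < s ! x" unfolding has_3412_def by blast
    have "filter (\<lambda>j. j \<in> {w, x, y, z}) [0..<length s] = [w, x, y, z]"
      by (rule sorted_distinct_set_unique) (use i in \<open>auto intro!: sorted_wrt_filter\<close>)
    then have "subseq [w, x, y, z] [0..<length s]" by (metis subseq_filter_left)
    then have "subseq (map ((!) s) [w, x, y, z]) (map ((!) s) [0..<length s])" by (rule subseq_map)
    then have "subseq [s ! w, s ! x, s ! y, s ! z] s" by (simp add: map_nth)
    then show "\<exists>xs. subseq xs s \<and> standardize xs = [3, 4, 1, 2]"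
      unfolding standardize_3412_iff using o by blast
  qed
  then show ?thesis by (simp add: avoids_def)
qed

text \<open>The last entry of the pattern is smaller than the first, whereas entries of \<open>xs\<close> are smaller than
  those of \<open>ys\<close> and stand before them. So an occurrence that ends in \<open>ys\<close> also starts there.\<close>

lemma has_3412_direct_sum:
  assumes "xs \<in> perms m" "ys \<in> perms n"
  shows "has_3412 (xs \<oplus> ys) \<longleftrightarrow> has_3412 xs \<or> has_3412 ys"
proof -
  have l: "length xs = m" "length ys = n" using assms by (simp_all add: length_perms)
  have nx: "(xs \<oplus> ys) ! i = xs ! i" "xs ! i \<le> m" if "i < m" for i
    using that l assms nth_mem[of i xs] by (auto simp: direct_sum_def nth_append perms_iff)
  have ny: "(xs \<oplus> ys) ! (i + m) = ys ! i + m" "1 \<le> ys ! i" if "i < n" for i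
    using that l assms nth_mem[of i ys] by (auto simp: direct_sum_def nth_append perms_iff)
  show ?thesis
  proof
    assume "has_3412 (xs \<oplus> ys)"
    then obtain w x y z where i: "w < x" "x < y" "y < z" "z < m + n"
      and o: "(xs \<oplus> ys) ! y < (xs \<oplus> ys) ! z" "(xs \<oplus> ys) ! z < (xs \<oplus> ys) ! w" "(xs \<oplus> ys) ! w < (xs \<oplus> ys) ! x"
      unfolding has_3412_def using l by auto
    show "has_3412 xs \<or> has_3412 ys"
    proof (cases "z < m")
      case True
      then have "xs ! y < xs ! z" "xs ! z < xs ! w" "xs ! w < xs ! x" "z < length xs"
        using i o nx(1)[of w] nx(1)[of x] nx(1)[of y] nx(1)[of z] l by auto
      then show ?thesis using i unfolding has_3412_def by blast
    next
      case False
      have "\<not> w < m"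
      proof
        assume w: "w < m"
        have z: "z - m < n" "z - m + m = z" using False i by auto
        show False using nx[OF w] ny[OF z(1)] o(2) unfolding z(2) by simp
      qed
      then obtain w' x' y' z' where j: "w = w' + m" "x = x' + m" "y = y' + m" "z = z' + m"
        using i that[of "w - m" "x - m" "y - m" "z - m"] by simp
      then have "w' < x'" "x' < y'" "y' < z'" "z' < n" using i by auto
      moreover from this have "ys ! y' < ys ! z'" "ys ! z' < ys ! w'" "ys ! w' < ys ! x'"
        using o ny[of w'] ny[of x'] ny[of y'] ny[of z'] unfolding j by auto
      ultimately show ?thesis unfolding has_3412_def using l by blast
    qed
  next
    assume "has_3412 xs \<or> has_3412 ys"
    then show "has_3412 (xs \<oplus> ys)"
    proof
      assume "has_3412 xs"
      then obtain w x y z where i: "w < x" "x < y" "y < z" "z < m"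
        and o: "xs ! y < xs ! z" "xs ! z < xs ! w" "xs ! w < xs ! x" unfolding has_3412_def using l by auto
      have "z < length (xs \<oplus> ys)" using i l by simp
      moreover have "(xs \<oplus> ys) ! y < (xs \<oplus> ys) ! z" "(xs \<oplus> ys) ! z < (xs \<oplus> ys) ! w"
        "(xs \<oplus> ys) ! w < (xs \<oplus> ys) ! x"
        using i o nx(1)[of w] nx(1)[of x] nx(1)[of y] nx(1)[of z] by auto
      ultimately show ?thesis unfolding has_3412_def using i by blast
    next
      assume "has_3412 ys"
      then obtain w x y z where i: "w < x" "x < y" "y < z" "z < n"
        and o: "ys ! y < ys ! z" "ys ! z < ys ! w" "ys ! w < ys ! x" unfolding has_3412_def using l by auto
      have "(xs \<oplus> ys) ! (y + m) < (xs \<oplus> ys) ! (z + m)" "(xs \<oplus> ys) ! (z + m) < (xs \<oplus> ys) ! (w + m)"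
        "(xs \<oplus> ys) ! (w + m) < (xs \<oplus> ys) ! (x + m)" using o ny[of w] ny[of x] ny[of y] ny[of z] i by auto
      moreover have "w + m < x + m" "x + m < y + m" "y + m < z + m" "z + m < length (xs \<oplus> ys)" using i l by auto
      ultimately show ?thesis unfolding has_3412_def by blast
    qed
  qed
qed

lemma arch_eq: "[1] \<ominus> t \<ominus> [1] = (length t + 2) # map (\<lambda>v. v + 1) t @ [1]"
  by (simp add: skew_sum_def)

text \<open>The maximum in front cannot play the 3, nor the minimum at the end the 2.\<close>

lemma has_3412_arch:
  assumes "t \<in> perms n"
  shows "has_3412 ([1] \<ominus> t \<ominus> [1]) \<longleftrightarrow> has_3412 t"
proof -
  let ?s = "[1] \<ominus> t \<ominus> [1]"
  have l: "length t = n" using assms by (simp add: length_perms)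
  have n0: "?s ! 0 = n + 2" "?s ! (n + 1) = 1" using l unfolding arch_eq by (simp_all add: nth_append)
  have nt: "?s ! (i + 1) = t ! i + 1" "1 \<le> t ! i" "t ! i \<le> n" if "i < n" for i
    using that l assms nth_mem[of i t] unfolding arch_eq by (auto simp: nth_append perms_iff)
  have bd: "1 \<le> ?s ! i" "?s ! i \<le> n + 2" if "i < n + 2" for i
  proof -
    have "i = 0 \<or> i = n + 1 \<or> (i = (i - 1) + 1 \<and> i - 1 < n)" using that by linarith
    then have "1 \<le> ?s ! i \<and> ?s ! i \<le> n + 2"
    proof (elim disjE conjE)
      assume j: "i = (i - 1) + 1" "i - 1 < n"
      show ?thesis using nt[OF j(2)] j(1) by simp
    qed (use n0 in simp_all)
    then show "1 \<le> ?s ! i" "?s ! i \<le> n + 2" by auto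
  qed
  show ?thesis
  proof
    assume "has_3412 ?s"
    then obtain w x y z where i: "w < x" "x < y" "y < z" "z < n + 2"
      and o: "?s ! y < ?s ! z" "?s ! z < ?s ! w" "?s ! w < ?s ! x"
      unfolding has_3412_def using l by auto
    have "w \<noteq> 0" using bd(2)[of x] i o n0 by (cases w) auto
    moreover have "z \<noteq> n + 1" using bd(1)[of y] i o n0 by auto
    ultimately obtain w' x' y' z' where j: "w = w' + 1" "x = x' + 1" "y = y' + 1" "z = z' + 1" "z' < n"
      using i that[of "w - 1" "x - 1" "y - 1" "z - 1"] by linarith
    then have "w' < x'" "x' < y'" "y' < z'" using i by auto
    moreover from this have "t ! y' < t ! z'" "t ! z' < t ! w'" "t ! w' < t ! x'"
      using o nt[of w'] nt[of x'] nt[of y'] nt[of z'] j(5) unfolding j(1-4) by auto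
    ultimately show "has_3412 t" unfolding has_3412_def using l j by blast
  next
    assume "has_3412 t"
    then obtain w x y z where i: "w < x" "x < y" "y < z" "z < n"
      and o: "t ! y < t ! z" "t ! z < t ! w" "t ! w < t ! x" unfolding has_3412_def using l by auto
    have "?s ! (y + 1) < ?s ! (z + 1)" "?s ! (z + 1) < ?s ! (w + 1)" "?s ! (w + 1) < ?s ! (x + 1)"
      using o nt[of w] nt[of x] nt[of y] nt[of z] i by auto
    moreover have "w + 1 < x + 1" "x + 1 < y + 1" "y + 1 < z + 1" "z + 1 < length ?s" using i l by auto
    ultimately show "has_3412 ?s" unfolding has_3412_def by blast
  qed
qed

lemma involution_iff:
  assumes s: "s \<in> perms n"
  shows "involution s \<longleftrightarrow> (\<forall>i<n. s ! (s ! i - 1) = i + 1)"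
proof -
  have l: "length s = n" using length_perms[OF s] .
  note inv = inverse_pair_perm_inverse[OF s]
  have "perm_inverse s = s \<longleftrightarrow> (\<forall>i<n. perm_inverse s ! i = s ! i)"
    by (auto simp: list_eq_iff_nth_eq length_perm_inverse l)
  also have "\<dots> \<longleftrightarrow> (\<forall>i<n. s ! (s ! i - 1) = i + 1)"
  proof (intro all_cong)
    fix i assume i: "i < n"
    have e: "entry (perm_inverse s) (i + 1) = perm_inverse s ! i" "entry s (s ! i) = s ! (s ! i - 1)"
      by (simp_all add: entry_def)
    have si: "1 \<le> s ! i" "s ! i \<le> n" using inverse_pairD(1,2)[OF inv, of "i + 1"] i by (auto simp: entry_def)
    show "perm_inverse s ! i = s ! i \<longleftrightarrow> s ! (s ! i - 1) = i + 1"
    proof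
      assume "perm_inverse s ! i = s ! i"
      then show "s ! (s ! i - 1) = i + 1"
        using inverse_pairD(6)[OF inv, of "i + 1"] i unfolding e(1) e(2)[symmetric] by simp
    next
      assume "s ! (s ! i - 1) = i + 1"
      then show "perm_inverse s ! i = s ! i"
        using inverse_pair_eq[OF inv si] unfolding e(2)[symmetric] e(1)[symmetric] by blast
    qed
  qed
  finally show ?thesis using s l by (simp add: involution_def)
qed

lemma involution_direct_sum:
  assumes "xs \<in> perms m" "ys \<in> perms n"
  shows "involution (xs \<oplus> ys) \<longleftrightarrow> involution xs \<and> involution ys"
proof -
  have l: "length xs = m" "length ys = n" using assms by (simp_all add: length_perms)
  have nx: "(xs \<oplus> ys) ! i = xs ! i" if "i < m" for i
    using that l by (auto simp: direct_sum_def nth_append)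
  have bx: "1 \<le> xs ! i" "xs ! i - 1 < m" if "i < m" for i
    using that l assms nth_mem[of i xs] by (auto simp: perms_iff)
  have ny: "(xs \<oplus> ys) ! (i + m) = ys ! i + m" if "i < n" for i
    using that l by (auto simp: direct_sum_def nth_append)
  have b_y: "1 \<le> ys ! i" "ys ! i - 1 < n" if "i < n" for i
    using that l assms nth_mem[of i ys] by (auto simp: perms_iff)
  have X: "(xs \<oplus> ys) ! ((xs \<oplus> ys) ! i - 1) = xs ! (xs ! i - 1)" if "i < m" for i
    using nx bx that by simp
  have Y: "(xs \<oplus> ys) ! ((xs \<oplus> ys) ! (i + m) - 1) = ys ! (ys ! i - 1) + m" if "i < n" for i
  proof -
    have e: "ys ! i + m - 1 = (ys ! i - 1) + m" using b_y[OF that] by simp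
    show ?thesis unfolding ny[OF that] e by (rule ny[OF b_y(2)[OF that]])
  qed
  have "(\<forall>i<m + n. (xs \<oplus> ys) ! ((xs \<oplus> ys) ! i - 1) = i + 1) \<longleftrightarrow>
    (\<forall>i<m. xs ! (xs ! i - 1) = i + 1) \<and> (\<forall>i<n. ys ! (ys ! i - 1) = i + 1)" (is "?L \<longleftrightarrow> ?R")
  proof
    assume a: ?L
    have "ys ! (ys ! i - 1) = i + 1" if "i < n" for i
      using a[rule_format, of "i + m"] Y[OF that] that by simp
    moreover have "xs ! (xs ! i - 1) = i + 1" if "i < m" for i
      using a[rule_format, of i] X[OF that] that by simp
    ultimately show ?R by blast
  next
    assume a: ?R
    show ?L
    proof (intro allI impI)
      fix i assume i: "i < m + n"
      show "(xs \<oplus> ys) ! ((xs \<oplus> ys) ! i - 1) = i + 1"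
      proof (cases "i < m")
        case True
        then show ?thesis using X[OF True] conjunct1[OF a] by simp
      next
        case False
        then have j: "i - m < n" "i - m + m = i" using i by auto
        have "ys ! (ys ! (i - m) - 1) = (i - m) + 1" using a j(1) by blast
        then show ?thesis using Y[OF j(1)] j(2) by simp
      qed
    qed
  qed
  then show ?thesis using involution_iff[OF assms(1)] involution_iff[OF assms(2)]
      involution_iff[OF direct_sum_in_perms[OF assms]] by simp
qed

lemma arch_in_perms:
  assumes "t \<in> perms n" shows "[1] \<ominus> t \<ominus> [1] \<in> perms (n + 2)"
proof -
  have "[1 :: nat] \<in> perms 1" by (simp add: perms_iff)
  from skew_sum_in_perms[OF skew_sum_in_perms[OF this assms] this] show ?thesis by simp
qed

lemma involution_arch:
  assumes "t \<in> perms n"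
  shows "involution ([1] \<ominus> t \<ominus> [1]) \<longleftrightarrow> involution t"
proof -
  let ?s = "[1] \<ominus> t \<ominus> [1]"
  have l: "length t = n" using assms by (simp add: length_perms)
  have n0: "?s ! 0 = n + 2" "?s ! (n + 1) = 1" using l unfolding arch_eq by (simp_all add: nth_append)
  have nt: "?s ! (i + 1) = t ! i + 1" "1 \<le> t ! i" "t ! i - 1 < n" if "i < n" for i
    using that l assms nth_mem[of i t] unfolding arch_eq by (auto simp: nth_append perms_iff)
  have T: "?s ! (?s ! (i + 1) - 1) = t ! (t ! i - 1) + 1" if "i < n" for i
  proof -
    have e: "t ! i + 1 - 1 = (t ! i - 1) + 1" using nt(2)[OF that] by simp
    show ?thesis unfolding nt(1)[OF that] e by (rule nt(1)[OF nt(3)[OF that]])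
  qed
  have "(\<forall>i<n + 2. ?s ! (?s ! i - 1) = i + 1) \<longleftrightarrow> (\<forall>i<n. t ! (t ! i - 1) = i + 1)" (is "?L \<longleftrightarrow> ?R")
  proof
    assume a: ?L
    show ?R
    proof (intro allI impI)
      fix i assume i: "i < n"
      then show "t ! (t ! i - 1) = i + 1" using a[rule_format, of "i + 1"] T[OF i] by simp
    qed
  next
    assume a: ?R
    show ?L
    proof (intro allI impI)
      fix i assume "i < n + 2"
      then have "i = 0 \<or> i = n + 1 \<or> (i = (i - 1) + 1 \<and> i - 1 < n)" by linarith
      then show "?s ! (?s ! i - 1) = i + 1"
      proof (elim disjE conjE)
        assume j: "i = (i - 1) + 1" "i - 1 < n"
        then show ?thesis using T[OF j(2)] a by simp
      qed (use n0 in simp_all)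
    qed
  qed
  then show ?thesis using involution_iff[OF assms] involution_iff[OF arch_in_perms[OF assms]] by simp
qed

lemma motzkin_perms: "motzkin s \<Longrightarrow> s \<in> perms (length s)"
proof (induction rule: motzkin.induct)
  case empty
  show ?case by (simp add: perms_iff)
next
  case (fixed r)
  have "[1 :: nat] \<in> perms 1" by (simp add: perms_iff)
  from direct_sum_in_perms[OF this fixed.IH] show ?case by simp
next
  case (arch t r)
  from direct_sum_in_perms[OF arch_in_perms[OF arch.IH(1)] arch.IH(2)] show ?case by simp
qed

lemma singleton_perm: "involution [1]" "\<not> has_3412 [1]" "[1 :: nat] \<in> perms 1"
proof -
  show p: "[1 :: nat] \<in> perms 1" by (simp add: perms_iff)
  show "involution [1]" using involution_iff[OF p] by simp
  show "\<not> has_3412 [1]" by (auto simp: has_3412_def)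
qed

lemma motzkin_imp:
  assumes "motzkin s"
  shows "involution s \<and> \<not> has_3412 s"
  using assms
proof (induction rule: motzkin.induct)
  case empty
  have "[] \<in> perms 0" by (simp add: perms_iff)
  then show ?case using involution_iff[of "[]" 0] by (simp add: has_3412_def)
next
  case (fixed r)
  note r = motzkin_perms[OF fixed.hyps]
  show ?case using involution_direct_sum[OF singleton_perm(3) r] has_3412_direct_sum[OF singleton_perm(3) r]
    fixed.IH singleton_perm by blast
next
  case (arch t r)
  note t = motzkin_perms[OF arch.hyps(1)] and r = motzkin_perms[OF arch.hyps(2)]
  note at = arch_in_perms[OF t]
  show ?case using involution_direct_sum[OF at r] has_3412_direct_sum[OF at r]
    involution_arch[OF t] has_3412_arch[OF t] arch.IH by blast
qed

text \<open>Let \<open>k\<close> be the first entry, so that \<open>s(k) = 1\<close>. If \<open>s(j) = m > k\<close> for some \<open>1 < j < k\<close>, then the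
  positions \<open>1, j, k, m\<close> carry \<open>k, m, 1, j\<close>, an occurrence of \<open>3412\<close>.\<close>

lemma involution_3412_first_block:
  assumes s: "s \<in> perms n" and inv: "involution s" and av: "\<not> has_3412 s"
    and n: "0 < n" and i: "i < s ! 0"
  shows "s ! i \<le> s ! 0"
proof (rule ccontr)
  assume c: "\<not> s ! i \<le> s ! 0"
  define k where "k = s ! 0"
  have l: "length s = n" using length_perms[OF s] .
  have b: "1 \<le> s ! j" "s ! j \<le> n" if "j < n" for j
    using that l s nth_mem[of j s] by (auto simp: perms_iff)
  have I: "s ! (s ! j - 1) = j + 1" if "j < n" for j using involution_iff[OF s] inv that by blast
  have k: "1 \<le> k" "k \<le> n" "s ! (k - 1) = 1" using b[OF n] I[OF n] by (auto simp: k_def)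
  have "i < n" using i k by (simp add: k_def)
  have "i \<noteq> 0" using c by (cases i) auto
  have "i \<noteq> k - 1" using c k by (auto simp: k_def)
  have m: "k < s ! i" "s ! i \<le> n" "s ! (s ! i - 1) = i + 1"
    using c b[OF \<open>i < n\<close>] I[OF \<open>i < n\<close>] by (auto simp: k_def)
  have "0 < i \<and> i < k - 1 \<and> k - 1 < s ! i - 1 \<and> s ! i - 1 < length s \<and>
     s ! (k - 1) < s ! (s ! i - 1) \<and> s ! (s ! i - 1) < s ! 0 \<and> s ! 0 < s ! i"
    using \<open>i \<noteq> 0\<close> \<open>i \<noteq> k - 1\<close> i m k l by (auto simp: k_def)
  then have "has_3412 s" unfolding has_3412_def by blast
  with av show False by simp
qed

text \<open>By the preceding lemma the first \<open>k\<close> entries form a permutation of \<open>{1..k}\<close>, which begins with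
  \<open>k\<close> and ends with 1. Both parts are again involutions avoiding the pattern.\<close>

lemma motzkin_if:
  assumes "s \<in> perms n" "involution s" "\<not> has_3412 s"
  shows "motzkin s"
  using assms
proof (induction n arbitrary: s rule: less_induct)
  case (less n)
  note s = less.prems(1) and inv = less.prems(2) and av = less.prems(3)
  have l: "length s = n" using length_perms[OF s] .
  show ?case
  proof (cases "n = 0")
    case True
    then show ?thesis using l motzkin.empty by simp
  next
    case False
    then have n: "0 < n" by simp
    define k where "k = s ! 0"
    have b: "1 \<le> s ! j" "s ! j \<le> n" if "j < n" for j
      using that l s nth_mem[of j s] by (auto simp: perms_iff)
    have I: "s ! (s ! j - 1) = j + 1" if "j < n" for j using involution_iff[OF s] inv that by blast
    have k: "1 \<le> k" "k \<le> n" "s ! (k - 1) = 1" using b[OF n] I[OF n] by (auto simp: k_def)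
    have low: "s ! j \<le> k" if "j < k" for j
      using involution_3412_first_block[OF s inv av n] that by (simp add: k_def)
    \<comment> \<open>Otherwise \<open>s\<close> would send the small value \<open>s ! j\<close> back to \<open>j + 1 > k\<close>.\<close>
    have high: "k < s ! j" if "k \<le> j" "j < n" for j
    proof (rule ccontr)
      assume "\<not> k < s ! j"
      then have "s ! j - 1 < k" using b(1)[OF that(2)] by linarith
      from low[OF this] I[OF that(2)] that(1) show False by simp
    qed
    have d: "distinct s" using s by (simp add: perms_iff)
    define h where "h = take k s"
    define r where "r = map (\<lambda>v. v - k) (drop k s)"
    have lh: "length h = k" and lr: "length r = n - k" using k l by (auto simp: h_def r_def)
    have hp: "h \<in> perms k"
    proof -
      have "h \<in> perms (length h)"
      proof (rule permsI)
        show "distinct h" using d by (simp add: h_def)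
        show "set h \<subseteq> {1..length h}"
        proof
          fix v assume "v \<in> set h"
          then obtain j where "j < k" "v = s ! j" using lh by (auto simp: in_set_conv_nth h_def)
          then show "v \<in> {1..length h}" using low b(1)[of j] k lh by auto
        qed
      qed
      then show ?thesis by (simp add: lh)
    qed
    have dk: "k < v \<and> v \<le> n" if "v \<in> set (drop k s)" for v
    proof -
      from that obtain j where "j < n - k" "v = s ! (k + j)" using l k by (auto simp: in_set_conv_nth)
      then show ?thesis using high[of "k + j"] b(2)[of "k + j"] by auto
    qed
    have rp: "r \<in> perms (n - k)"
    proof -
      have "r \<in> perms (length r)"
      proof (rule permsI)
        have "inj_on (\<lambda>v. v - k) (set (drop k s))"
        proof (rule inj_onI)
          fix v w assume "v \<in> set (drop k s)" "w \<in> set (drop k s)" "v - k = w - k"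
          then show "v = w" using dk[of v] dk[of w] by linarith
        qed
        then show "distinct r" using d by (simp add: r_def distinct_map)
        show "set r \<subseteq> {1..length r}"
        proof
          fix w assume "w \<in> set r"
          then obtain v where "v \<in> set (drop k s)" "w = v - k" by (auto simp: r_def)
          then show "w \<in> {1..length r}" using dk[of v] lr by auto
        qed
      qed
      then show ?thesis by (simp add: lr)
    qed
    have "map (\<lambda>v. v + k) r = drop k s"
    proof -
      have "map (\<lambda>v. v - k + k) (drop k s) = map (\<lambda>v. v) (drop k s)"
        by (rule map_cong[OF refl]) (use dk in force)
      then show ?thesis by (simp add: r_def o_def)
    qed
    then have seq: "s = h \<oplus> r" unfolding direct_sum_def lh by (simp add: h_def)
    have hr: "involution h" "involution r" "\<not> has_3412 h" "\<not> has_3412 r"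
      using inv av involution_direct_sum[OF hp rp] has_3412_direct_sum[OF hp rp] unfolding seq by blast+
    have "motzkin r" using less.IH[OF _ rp] hr k n by simp
    show ?thesis
    proof (cases "k = 1")
      case True
      have "h = [1]" using True lh l n by (cases s) (auto simp: h_def k_def)
      then show ?thesis unfolding seq using motzkin.fixed[OF \<open>motzkin r\<close>] by simp
    next
      case False
      then have k2: "2 \<le> k" using k by simp
      define M where "M = k - 2"
      have kM: "k = M + 2" using k2 by (simp add: M_def)
      define m where "m = take M (drop 1 s)"
      have lm: "length m = M" using kM k l by (simp add: m_def)
      have heq: "h = k # m @ [1]"
      proof (rule nth_equalityI)
        show "length h = length (k # m @ [1])" using lh lm kM by simp
        fix j assume "j < length h"
        then have "j = 0 \<or> j = k - 1 \<or> (j = (j - 1) + 1 \<and> j - 1 < M)" using lh kM by linarith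
        then show "h ! j = (k # m @ [1]) ! j"
        proof (elim disjE conjE)
          assume "j = 0" then show ?thesis using k by (simp add: h_def k_def)
        next
          assume "j = k - 1"
          then show ?thesis using k kM lm by (simp add: h_def nth_append)
        next
          assume j: "j = (j - 1) + 1" "j - 1 < M"
          then obtain j' where j': "j = Suc j'" "j' < M" by (cases j) auto
          then show ?thesis using kM lm l k by (simp add: h_def m_def nth_append)
        qed
      qed
      have dh: "distinct h" "set h = {1..k}" using hp by (auto simp: perms_iff)
      have mb: "2 \<le> v \<and> v \<le> M + 1" if "v \<in> set m" for v
      proof -
        have "v \<in> {1..k}" "v \<noteq> 1" "v \<noteq> k" using that dh unfolding heq by auto
        then show ?thesis using kM by auto
      qed
      define t where "t = map (\<lambda>v. v - 1) m"
      have lt: "length t = M" by (simp add: t_def lm)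
      have tp: "t \<in> perms M"
      proof -
        have "t \<in> perms (length t)"
        proof (rule permsI)
          have "inj_on (\<lambda>v. v - 1) (set m)"
          proof (rule inj_onI)
            fix v w assume "v \<in> set m" "w \<in> set m" "v - 1 = w - 1"
            then show "v = w" using mb[of v] mb[of w] by linarith
          qed
          moreover have "distinct m" using dh(1) unfolding heq by simp
          ultimately show "distinct t" by (simp add: t_def distinct_map)
          show "set t \<subseteq> {1..length t}"
          proof
            fix w assume "w \<in> set t"
            then obtain v where "v \<in> set m" "w = v - 1" by (auto simp: t_def)
            then show "w \<in> {1..length t}" using mb[of v] lt by auto
          qed
        qed
        then show ?thesis by (simp add: lt)
      qed
      have "map (\<lambda>v. v + 1) t = m"
      proof -
        have "map (\<lambda>v. v - 1 + 1) m = map (\<lambda>v. v) m"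
          by (rule map_cong[OF refl]) (use mb in force)
        then show ?thesis by (simp add: t_def o_def)
      qed
      then have ht: "h = [1] \<ominus> t \<ominus> [1]" unfolding arch_eq lt heq kM by simp
      have "involution t" "\<not> has_3412 t"
        using hr involution_arch[OF tp] has_3412_arch[OF tp] unfolding ht by blast+
      moreover have "M < n" using kM k by simp
      ultimately have "motzkin t" using less.IH[OF _ tp] by blast
      then show ?thesis unfolding seq ht using \<open>motzkin r\<close> by (rule motzkin.arch)
    qed
  qed
qed

lemma motzkin_iff:
  "motzkin s \<longleftrightarrow> s \<in> perms (length s) \<and> involution s \<and> avoids s [3, 4, 1, 2]"
  using motzkin_perms motzkin_imp motzkin_if avoids_3412_iff by blast

section \<open>Increasing odd threads and decreasing even threads\<close>

lemma direct_sum_cancel: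
  assumes "xs \<oplus> ys = xs' \<oplus> ys'" "length xs = length xs'"
  shows "xs = xs'" "ys = ys'"
  using assms by (auto simp: direct_sum_def dest: map_injective[OF _ injI])

lemma skew_sum_cancel:
  assumes "xs \<ominus> ys = xs' \<ominus> ys'" "length ys = length ys'"
  shows "xs = xs'" "ys = ys'"
  using assms by (auto simp: skew_sum_def dest: map_injective[OF _ injI])

lemma direct_sum_increasing: "increasing_perm m \<oplus> increasing_perm n = increasing_perm (m + n)"
  by (rule nth_equalityI) (auto simp: direct_sum_def increasing_perm_def nth_append simp del: upt_Suc)

lemma perm_complement_increasing: "perm_complement (increasing_perm n) = decreasing_perm n"
  by (rule nth_equalityI)
    (auto simp: perm_complement_def increasing_perm_def decreasing_perm_def rev_nth simp del: upt_Suc)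

lemma perm_complement_decreasing: "perm_complement (decreasing_perm n) = increasing_perm n"
  unfolding perm_complement_increasing[symmetric]
  by (rule perm_complement_involutive[OF increasing_perm_in_perms])

lemma decreasing_perm_in_perms: "decreasing_perm n \<in> perms n"
  unfolding perm_complement_increasing[symmetric]
  by (rule perm_complement_in_perms[OF increasing_perm_in_perms])

lemma length_decreasing_perm [simp]: "length (decreasing_perm n) = n"
  using length_perms[OF decreasing_perm_in_perms] .

lemma set_perm_subset: "p \<in> perms n \<Longrightarrow> set p \<subseteq> {1..length p}"
  using length_perms by (auto simp: perms_iff)

lemma skew_sum_decreasing: "decreasing_perm m \<ominus> decreasing_perm n = decreasing_perm (m + n)"
  using perm_complement_direct_sum[OF set_perm_subset[OF increasing_perm_in_perms], of m "increasing_perm n"]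
  by (simp add: direct_sum_increasing perm_complement_increasing)

lemma unit_perm: "increasing_perm 1 = [1]" "decreasing_perm 1 = [1]" "decreasing_perm 0 = []"
  by (simp_all add: increasing_perm_def decreasing_perm_def)

text \<open>The reason why an increasing odd thread comes from a frame or from \<open>123\<close>.\<close>

lemma skew_sum_ne_increasing:
  assumes "xs \<in> perms m" "ys \<in> perms n" "1 \<le> m" "1 \<le> n"
  shows "xs \<ominus> ys \<noteq> increasing_perm k"
proof
  assume e: "xs \<ominus> ys = increasing_perm k"
  have l: "length xs = m" "length ys = n" using assms length_perms by auto
  have "m + n = k" using arg_cong[OF e, of length] l by simp
  then have "increasing_perm k ! 0 = 1" using assms by (simp add: increasing_perm_def del: upt_Suc)
  moreover have "(xs \<ominus> ys) ! 0 = xs ! 0 + n" using l assms by (simp add: skew_sum_def nth_append)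
  moreover have "1 \<le> xs ! 0" using assms l nth_mem[of 0 xs] by (auto simp: perms_iff)
  ultimately show False using e assms by simp
qed

lemma frame_decreasing: "frame 1 (decreasing_perm d) = increasing_perm (d + 2)"
  by (simp add: frame_def perm_complement_decreasing direct_sum_increasing)

lemma frame_eq_increasing:
  assumes x: "x \<in> perms d" and e: "frame 1 x = increasing_perm n"
  shows "x = decreasing_perm d"
proof -
  have "n = d + 2" using arg_cong[OF e, of length] length_perms[OF x] by simp
  then have "frame 1 x = frame 1 (decreasing_perm d)" using e frame_decreasing by simp
  then have "increasing_perm 1 \<oplus> perm_complement x = increasing_perm 1 \<oplus> perm_complement (decreasing_perm d)"
    unfolding frame_def by (rule direct_sum_cancel(1)) (simp add: length_perms[OF x])
  then have "perm_complement x = perm_complement (decreasing_perm d)"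
    by (rule direct_sum_cancel(2)) simp
  then show ?thesis using perm_complement_involutive[OF x] perm_complement_involutive[OF decreasing_perm_in_perms] by metis
qed

lemma perm_complement_frame:
  assumes x: "x \<in> perms d"
  shows "perm_complement (frame 1 x) = [1] \<ominus> x \<ominus> [1]"
proof -
  have 1: "set [1 :: nat] \<subseteq> {1..length [1 :: nat]}" by simp
  have c1: "perm_complement [1] = [1]" by (simp add: perm_complement_def)
  have "[1] \<oplus> perm_complement x \<in> perms (1 + d)"
    using direct_sum_in_perms[OF singleton_perm(3) perm_complement_in_perms[OF x]] .
  from perm_complement_direct_sum[OF set_perm_subset[OF this]] perm_complement_direct_sum[OF 1]
  show ?thesis unfolding frame_def unit_perm by (simp only: c1 perm_complement_involutive[OF x])
qed

lemma grown_perms: "grown p \<Longrightarrow> p \<in> perms (length p)"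
  using leopard_list_if_grown leopard_list_perms by blast

lemma grown_quarter_perms:
  assumes "grown p"
  shows "quarter_even p \<in> perms (length (quarter_even p))"
    and "quarter_odd p \<in> perms (length (quarter_even p) + 1)"
  using grown_quarters[OF assms] length_perms by force+

lemma quarters_123: "quarter_even [1, 2, 3] = []" "quarter_odd [1, 2, 3] = [1]"
  by (simp_all add: quarter_even_def quarter_odd_def)

lemma grown_quarter_frame:
  assumes "grown p"
  shows "quarter_even (frame 2 p) = perm_complement (quarter_odd p)"
    and "quarter_odd (frame 2 p) = frame 1 (quarter_even p)"
proof -
  obtain d where d: "length p = 4 * d + 3" "quarter_even p \<in> perms d" "quarter_odd p \<in> perms (d + 1)"
    using grown_quarters[OF assms] by blast
  show "quarter_even (frame 2 p) = perm_complement (quarter_odd p)"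
    "quarter_odd (frame 2 p) = frame 1 (quarter_even p)"
    using quarter_frame[of p d] grown_perms[OF assms] d length_perms by auto
qed

lemma grown_quarter_skew_sum:
  assumes "grown r"
  shows "quarter_even (q \<ominus> [1] \<ominus> r) = quarter_even q \<ominus> [1] \<ominus> quarter_even r"
    and "quarter_odd (q \<ominus> [1] \<ominus> r) = quarter_odd q \<ominus> quarter_odd r"
proof -
  obtain d where d: "length r = 4 * d + 3" "quarter_even r \<in> perms d" "quarter_odd r \<in> perms (d + 1)"
    using grown_quarters[OF assms] by blast
  show "quarter_even (q \<ominus> [1] \<ominus> r) = quarter_even q \<ominus> [1] \<ominus> quarter_even r"
    "quarter_odd (q \<ominus> [1] \<ominus> r) = quarter_odd q \<ominus> quarter_odd r"
    using quarter_skew_sum[of r d q] d length_perms by auto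
qed

lemma skew_sum_eq_decreasing:
  assumes e: "xs \<ominus> [1] \<ominus> ys = decreasing_perm n"
  shows "xs = decreasing_perm (length xs)" "ys = decreasing_perm (length ys)"
proof -
  have "length xs + 1 + length ys = n" using arg_cong[OF e, of length] by simp
  then have "decreasing_perm n = decreasing_perm (length xs) \<ominus> [1] \<ominus> decreasing_perm (length ys)"
    using skew_sum_decreasing[of "length xs + 1" "length ys"] skew_sum_decreasing[of "length xs" 1]
    by (simp only: unit_perm)
  with e have "xs \<ominus> [1] \<ominus> ys = decreasing_perm (length xs) \<ominus> [1] \<ominus> decreasing_perm (length ys)" by simp
  from skew_sum_cancel[OF this] have *: "xs \<ominus> [1] = decreasing_perm (length xs) \<ominus> [1]" "ys = decreasing_perm (length ys)"
    by simp_all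
  then show "ys = decreasing_perm (length ys)" by simp
  from skew_sum_cancel(1)[OF *(1)] show "xs = decreasing_perm (length xs)" by simp
qed

text \<open>The two claims need each other: a frame exchanges the threads up to complement, and turns an
  increasing odd thread into a decreasing even one.\<close>

lemma grown_extreme_thread:
  assumes "grown p"
  shows "(\<forall>n. quarter_odd p = increasing_perm n \<longrightarrow> motzkin (quarter_even p)) \<and>
    (\<forall>n. quarter_even p = decreasing_perm n \<longrightarrow> motzkin (perm_complement (quarter_odd p)))"
  using assms
proof (induction rule: grown.induct)
  case start
  have "motzkin ([1] \<oplus> [])" by (intro motzkin.intros)
  then have "motzkin [1]" by (simp add: direct_sum_def)
  moreover have "perm_complement [1] = [1]" by (simp add: perm_complement_def)
  ultimately show ?case unfolding quarters_123 using motzkin.empty by simp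
next
  case (frame p)
  note f = grown_quarter_frame[OF frame.hyps] and qp = grown_quarter_perms[OF frame.hyps]
  show ?case unfolding f
  proof (intro conjI allI impI)
    fix n assume "frame 1 (quarter_even p) = increasing_perm n"
    from frame_eq_increasing[OF qp(1) this] show "motzkin (perm_complement (quarter_odd p))" using frame.IH by blast
  next
    fix n assume "perm_complement (quarter_odd p) = decreasing_perm n"
    then have "quarter_odd p = increasing_perm n"
      using perm_complement_involutive[OF qp(2)] perm_complement_decreasing by metis
    then have "motzkin (quarter_even p)" using frame.IH by blast
    from motzkin.arch[OF this motzkin.empty] show "motzkin (perm_complement (frame 1 (quarter_even p)))"
      unfolding perm_complement_frame[OF qp(1)] by (simp add: direct_sum_def)
  qed
next
  case (start_skew q)
  note f = grown_quarter_skew_sum[OF start_skew.hyps, of "[1, 2, 3]", unfolded quarters_123]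
    and qp = grown_quarter_perms[OF start_skew.hyps]
  show ?case unfolding f
  proof (intro conjI allI impI)
    fix n assume "[1] \<ominus> quarter_odd q = increasing_perm n"
    then show "motzkin ([] \<ominus> [1] \<ominus> quarter_even q)"
      using skew_sum_ne_increasing[OF singleton_perm(3) qp(2), of n] by simp
  next
    fix n assume "[] \<ominus> [1] \<ominus> quarter_even q = decreasing_perm n"
    from skew_sum_eq_decreasing(2)[OF this] have "motzkin (perm_complement (quarter_odd q))"
      using start_skew.IH by blast
    from motzkin.fixed[OF this] show "motzkin (perm_complement ([1] \<ominus> quarter_odd q))"
      unfolding perm_complement_skew_sum[OF set_perm_subset[OF qp(2)]] by (simp add: perm_complement_def)
  qed
next
  case (frame_skew p q)
  note f = grown_quarter_skew_sum[OF frame_skew.hyps(2), of "frame 2 p", unfolded grown_quarter_frame[OF frame_skew.hyps(1)]]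
    and pp = grown_quarter_perms[OF frame_skew.hyps(1)] and qp = grown_quarter_perms[OF frame_skew.hyps(2)]
  show ?case unfolding f
  proof (intro conjI allI impI)
    fix n assume "frame 1 (quarter_even p) \<ominus> quarter_odd q = increasing_perm n"
    then show "motzkin (perm_complement (quarter_odd p) \<ominus> [1] \<ominus> quarter_even q)"
      using skew_sum_ne_increasing[OF frame_in_perms[OF pp(1), of 1] qp(2), of n] by simp
  next
    fix n assume e: "perm_complement (quarter_odd p) \<ominus> [1] \<ominus> quarter_even q = decreasing_perm n"
    note d = skew_sum_eq_decreasing[OF e]
    have "motzkin (perm_complement (quarter_odd q))" using frame_skew.IH(2) d(2) by blast
    moreover have "quarter_odd p = increasing_perm (length (perm_complement (quarter_odd p)))"
      using d(1) perm_complement_involutive[OF pp(2)] perm_complement_decreasing by metis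
    then have "motzkin (quarter_even p)" using frame_skew.IH(1) by blast
    ultimately show "motzkin (perm_complement (frame 1 (quarter_even p) \<ominus> quarter_odd q))"
      unfolding perm_complement_skew_sum[OF set_perm_subset[OF qp(2)]] perm_complement_frame[OF pp(1)]
      using motzkin.arch by blast
  qed
qed

text \<open>One frame around a permutation with decreasing even thread and odd thread \<open>c(s)\<close> gives an
  increasing odd thread and the even thread \<open>c(c(s)) = s\<close>.\<close>

lemma increasing_thread_of_decreasing_thread:
  assumes s: "motzkin s" "s \<noteq> []"
    and p: "\<exists>p. grown p \<and> quarter_even p = decreasing_perm (length s - 1) \<and> quarter_odd p = perm_complement s"
  shows "\<exists>p. grown p \<and> quarter_odd p = increasing_perm (length s + 1) \<and> quarter_even p = s"
proof -
  obtain q where q: "grown q" "quarter_even q = decreasing_perm (length s - 1)" "quarter_odd q = perm_complement s"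
    using p by blast
  have "length s - 1 + 2 = length s + 1" using s(2) by (cases s) auto
  then have "quarter_odd (frame 2 q) = increasing_perm (length s + 1)" "quarter_even (frame 2 q) = s"
    using grown_quarter_frame[OF q(1)] q(2,3) frame_decreasing perm_complement_involutive[OF motzkin_perms[OF s(1)]]
    by simp_all
  then show ?thesis using grown.frame[OF q(1)] by blast
qed

text \<open>The decreasing case is built along the recursion; the increasing one follows by a frame. The
  block \<open>1 \<ominus> t \<ominus> 1\<close> arises by a frame around a permutation with even thread \<open>t\<close> and increasing odd
  thread. The empty involution is excluded in the decreasing case, since odd
  threads over a decreasing even thread are nonempty.\<close>

lemma motzkin_extreme_thread:
  assumes "motzkin s"
  shows "(\<exists>p. grown p \<and> quarter_odd p = increasing_perm (length s + 1) \<and> quarter_even p = s) \<and>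
    (s \<noteq> [] \<longrightarrow> (\<exists>p. grown p \<and> quarter_even p = decreasing_perm (length s - 1) \<and> quarter_odd p = perm_complement s))"
  using assms
proof (induction rule: motzkin.induct)
  case empty
  have "grown [1, 2, 3] \<and> quarter_odd [1, 2, 3] = increasing_perm (length [] + 1) \<and> quarter_even [1, 2, 3] = []"
    using grown.start quarters_123 unit_perm(1) by simp
  then show ?case by blast
next
  case (fixed r)
  let ?s = "[1] \<oplus> r"
  have c: "perm_complement ?s = [1] \<ominus> perm_complement r"
    using perm_complement_direct_sum[of "[1]" r] by (simp add: perm_complement_def)
  have B: "\<exists>p. grown p \<and> quarter_even p = decreasing_perm (length ?s - 1) \<and> quarter_odd p = perm_complement ?s"
  proof (cases "r = []")
    case True
    then show ?thesis using grown.start quarters_123 unit_perm(3)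
      by (intro exI[of _ "[1, 2, 3]"]) (auto simp: direct_sum_def perm_complement_def)
  next
    case False
    then obtain p where p: "grown p" "quarter_even p = decreasing_perm (length r - 1)" "quarter_odd p = perm_complement r"
      using fixed.IH by blast
    have "1 + (length r - 1) = length ?s - 1" using False by (cases r) auto
    then have "[] \<ominus> [1] \<ominus> decreasing_perm (length r - 1) = decreasing_perm (length ?s - 1)"
      using skew_sum_decreasing[of 1 "length r - 1"] unfolding unit_perm by (simp add: skew_sum_def)
    then show ?thesis using p grown.start_skew[OF p(1)] grown_quarter_skew_sum[OF p(1), of "[1, 2, 3]"] c
      unfolding quarters_123 by (intro exI[of _ "[1, 2, 3] \<ominus> [1] \<ominus> p"]) simp
  qed
  have "?s \<noteq> []" by (simp add: direct_sum_def skew_sum_def)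
  from increasing_thread_of_decreasing_thread[OF motzkin.fixed[OF fixed.hyps] this B] B show ?case by blast
next
  case (arch t r)
  let ?s = "[1] \<ominus> t \<ominus> [1] \<oplus> r"
  note tp = motzkin_perms[OF arch.hyps(1)]
  obtain u where u: "grown u" "quarter_odd u = increasing_perm (length t + 1)" "quarter_even u = t"
    using arch.IH(1) by blast
  have fu: "quarter_even (frame 2 u) = decreasing_perm (length t + 1)" "quarter_odd (frame 2 u) = frame 1 t"
    using grown_quarter_frame[OF u(1)] u perm_complement_increasing by simp_all
  have ct: "perm_complement ([1] \<ominus> t \<ominus> [1]) = frame 1 t"
    using perm_complement_frame[OF tp] perm_complement_involutive[OF frame_in_perms[OF tp, of 1]] by simp
  have c: "perm_complement ?s = frame 1 t \<ominus> perm_complement r"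
    using perm_complement_direct_sum[OF set_perm_subset[OF arch_in_perms[OF tp]], of r] ct by simp
  have B: "\<exists>p. grown p \<and> quarter_even p = decreasing_perm (length ?s - 1) \<and> quarter_odd p = perm_complement ?s"
  proof (cases "r = []")
    case True
    then show ?thesis using grown.frame[OF u(1)] fu c
      by (intro exI[of _ "frame 2 u"]) (auto simp: perm_complement_def skew_sum_def)
  next
    case False
    then obtain p where p: "grown p" "quarter_even p = decreasing_perm (length r - 1)" "quarter_odd p = perm_complement r"
      using arch.IH(2) by blast
    have "length t + 1 + 1 + (length r - 1) = length ?s - 1" using False by (cases r) auto
    then have "decreasing_perm (length t + 1) \<ominus> [1] \<ominus> decreasing_perm (length r - 1) = decreasing_perm (length ?s - 1)"
      using skew_sum_decreasing[of "length t + 1 + 1" "length r - 1"] skew_sum_decreasing[of "length t + 1" 1]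
      by (simp only: unit_perm)
    then show ?thesis using p grown.frame_skew[OF u(1) p(1)] grown_quarter_skew_sum[OF p(1), of "frame 2 u"] c fu
      by (intro exI[of _ "frame 2 u \<ominus> [1] \<ominus> p"]) simp
  qed
  have "?s \<noteq> []" by (simp add: direct_sum_def skew_sum_def)
  from increasing_thread_of_decreasing_thread[OF motzkin.arch[OF arch.hyps] this B] B show ?case by blast
qed

theorem theorem5p1:
  "(\<forall>n::nat. n \<ge> 1 \<longrightarrow>
      {a. even_thread a \<and> entangled a (Perm (increasing_perm n))} =
      {Perm s | s. s \<in> perms (n - 1) \<and> involution s \<and> avoids s [3, 4, 1, 2]}) \<and>
   (\<forall>n::nat.
      {b. odd_thread b \<and> entangled (Perm (decreasing_perm n)) b} =
      {Perm (perm_complement s) | s. s \<in> perms (n + 1) \<and> involution s \<and> avoids s [3, 4, 1, 2]})"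
proof (intro conjI allI impI)
  have motz: "s \<in> perms m \<and> involution s \<and> avoids s [3, 4, 1, 2] \<longleftrightarrow> motzkin s \<and> length s = m" for s m
    using motzkin_iff[of s] length_perms[of s m] by auto
  have threads: "even_thread a" "odd_thread b" if "entangled a b" for a b
    using that unfolding entangled_def by blast+
  fix n :: nat
  {
    assume n: "n \<ge> 1"
    have "length (increasing_perm n) \<noteq> 0" using n by simp
    then have "increasing_perm n \<noteq> []" by blast
    have "{a. even_thread a \<and> entangled a (Perm (increasing_perm n))} = {a. entangled a (Perm (increasing_perm n))}"
      using threads by blast
    also have "\<dots> = {Perm (quarter_even p) | p. grown p \<and> quarter_odd p = increasing_perm n}"
      using entangled_iff[of _ "Perm (increasing_perm n)"] \<open>increasing_perm n \<noteq> []\<close> by auto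
    also have "\<dots> = {Perm s | s. motzkin s \<and> length s = n - 1}"
    proof (intro set_eqI iffI)
      fix a assume "a \<in> {Perm (quarter_even p) | p. grown p \<and> quarter_odd p = increasing_perm n}"
      then obtain p where p: "a = Perm (quarter_even p)" "grown p" "quarter_odd p = increasing_perm n" by blast
      have "length (quarter_even p) = n - 1" using length_perms[OF grown_quarter_perms(2)[OF p(2)]] p(3) by simp
      then show "a \<in> {Perm s | s. motzkin s \<and> length s = n - 1}" using grown_extreme_thread[OF p(2)] p by blast
    next
      fix a assume "a \<in> {Perm s | s. motzkin s \<and> length s = n - 1}"
      then obtain s where s: "a = Perm s" "motzkin s" "length s + 1 = n" using n by auto
      then show "a \<in> {Perm (quarter_even p) | p. grown p \<and> quarter_odd p = increasing_perm n}"
        using motzkin_extreme_thread[OF s(2)] by blast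
    qed
    finally show "{a. even_thread a \<and> entangled a (Perm (increasing_perm n))} =
      {Perm s | s. s \<in> perms (n - 1) \<and> involution s \<and> avoids s [3, 4, 1, 2]}" unfolding motz .
  }
  have "{b. odd_thread b \<and> entangled (Perm (decreasing_perm n)) b} = {b. entangled (Perm (decreasing_perm n)) b}"
    using threads by blast
  also have "\<dots> = {Perm (quarter_odd p) | p. grown p \<and> quarter_even p = decreasing_perm n}"
    using entangled_iff[of "Perm (decreasing_perm n)"] by auto
  also have "\<dots> = {Perm (perm_complement s) | s. motzkin s \<and> length s = n + 1}"
  proof (intro set_eqI iffI)
    fix b assume "b \<in> {Perm (quarter_odd p) | p. grown p \<and> quarter_even p = decreasing_perm n}"
    then obtain p where p: "b = Perm (quarter_odd p)" "grown p" "quarter_even p = decreasing_perm n" by blast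
    note q = grown_quarter_perms(2)[OF p(2)]
    have "length (perm_complement (quarter_odd p)) = n + 1" using length_perms[OF q] p(3) by simp
    moreover have "quarter_odd p = perm_complement (perm_complement (quarter_odd p))"
      using perm_complement_involutive[OF q] by simp
    ultimately show "b \<in> {Perm (perm_complement s) | s. motzkin s \<and> length s = n + 1}"
      using grown_extreme_thread[OF p(2)] p by blast
  next
    fix b assume "b \<in> {Perm (perm_complement s) | s. motzkin s \<and> length s = n + 1}"
    then obtain s where s: "b = Perm (perm_complement s)" "motzkin s" "length s = n + 1" by blast
    then have "s \<noteq> []" "length s - 1 = n" by auto
    with s obtain p where "grown p" "quarter_even p = decreasing_perm n" "quarter_odd p = perm_complement s"
      using motzkin_extreme_thread[OF s(2)] by auto
    with s(1) show "b \<in> {Perm (quarter_odd p) | p. grown p \<and> quarter_even p = decreasing_perm n}"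
      by (metis (mono_tags, lifting) mem_Collect_eq)
  qed
  finally show "{b. odd_thread b \<and> entangled (Perm (decreasing_perm n)) b} =
      {Perm (perm_complement s) | s. s \<in> perms (n + 1) \<and> involution s \<and> avoids s [3, 4, 1, 2]}"
    unfolding motz .
qed

end
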